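(* Let $\{x_{i,k}\}$ be produced by the algorithm DSAAWET (defined in the context) with arbitrary initial values $x_{i,0}\in\mathbb{R}^l$, $i\in\mathcal{V}$. Assume conditions A1, A2, A3, A4 stated in the context. Then for any sample path $\omega$ for which condition A5 holds, the following assertions hold. (i) For every $i\in\mathcal{V}$ the sequence $\{x_{i,k}\}$ is bounded, and there exists a positive integer $k_0$, possibly depending on $\omega$, such that $$x_{i,k+1}=\sum_{j\in N_i(k)}\omega_{ij}(k)x_{j,k}+\gamma_k O_{i,k+1}\qquad \forall k\ge k_0,\ \forall i\in\mathcal V,$$ or, in compact form, $$X_{k+1}=(W(k)\otimes \mathbf{I}_l)X_k+\gamma_k\big(F(X_k)+\varepsilon_{k+1}\big)\qquad \forall k\ge k_0 .$$ (ii) $X_{\bot,k}\to \mathbf{0}$ and $d(x_k,J)\to 0$ as $k\to\infty$. (iii) There exists a connected subset $J^*\subset J$ such that $d(x_k,J^* )\to 0$ as $k\to\infty$.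
   Context: Setting. $\mathcal V=\{1,\dots,N\}$ is a set of agents, $f_i:\mathbb{R}^l\to\mathbb{R}^l$ ($i\in\mathcal V$) are local functions, $f=\frac1N\sum_{i=1}^N f_i$, $J=\{x\in\mathbb{R}^l: f(x)=0\}$, and $d(x,S)=\min_{y}\{\|x-y\|:y\in S\}$ (inf if the minimum is not attained); $\|\cdot\|$ is the Euclidean norm. $I_{[\cdot]}$ denotes the indicator (1 if the condition holds, 0 otherwise). At each time $k=0,1,2,\dots$ communication is described by a digraph $\mathcal G(k)=\{\mathcal V,\mathcal E(k)\}$ with nonnegative adjacency matrix $W(k)=[\omega_{ij}(k)]_{i,j=1}^N$, where $\omega_{ij}(k)>0$ if and only if $(j,i)\in\mathcal E(k)$; $N_i(k)=\{j\in\mathcal V:(j,i)\in\mathcal E(k)\}$, and $i\in N_i(k)$ for all $i,k$. Observations: $O_{i,k+1}=f_i(x_{i,k})+\varepsilon_{i,k+1}$. On a probability space $(\Omega,\mathcal F,\mathbb P)$ the noise is $\varepsilon_{i,k+1}=\varepsilon_{i,k+1}(x_{i,k}(\omega),\omega)$, where $\varepsilon_{i,k+1}(\cdot,\cdot):\mathbb{R}^l\times\Omega\to\mathbb{R}^l$ is measurable (state-dependent noise). Algorithm DSAAWET. Let $\{\gamma_k\}$ be step sizes, $x^*\in\mathbb{R}^l$ a fixed vector known to all agents, and $\{M_k\}_{k\ge0}$ a sequence of positive numbers increasingly diverging to infinity with $M_0\ge\|x^*\|$. With $\sigma_{i,0}=0$ for all $i$, define for $k\ge0$, $i\in\mathcal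 V$: $$\hat\sigma_{i,k}=\max_{j\in N_i(k)}\sigma_{j,k},$$ $$x'_{i,k+1}=\Big(\sum_{j\in N_i(k)}\omega_{ij}(k)\big(x_{j,k}I_{[\sigma_{j,k}=\hat\sigma_{i,k}]}+x^*I_{[\sigma_{j,k}<\hat\sigma_{i,k}]}\big)+\gamma_kO_{i,k+1}\Big)I_{[\sigma_{i,k}=\hat\sigma_{i,k}]}+x^*I_{[\sigma_{i,k}<\hat\sigma_{i,k}]},$$ $$x_{i,k+1}=x^*I_{[\|x'_{i,k+1}\|>M_{\hat\sigma_{i,k}}]}+x'_{i,k+1}I_{[\|x'_{i,k+1}\|\le M_{\hat\sigma_{i,k}}]},\qquad \sigma_{i,k+1}=\hat\sigma_{i,k}+I_{[\|x'_{i,k+1}\|>M_{\hat\sigma_{i,k}}]}.$$ Notation: $X_k=col\{x_{1,k},\dots,x_{N,k}\}$ (stacked column vector), $\varepsilon_k=col\{\varepsilon_{1,k},\dots,\varepsilon_{N,k}\}$, $F(X_k)=col\{f_1(x_{1,k}),\dots,f_N(x_{N,k})\}$, $x_k=\frac1N\sum_{i=1}^Nx_{i,k}$, $D_\bot=(\mathbf I_N-\frac{\mathbf 1\mathbf 1^T}{N})\otimes\mathbf I_l$, $X_{\bot,k}=D_\bot X_k$; $\otimes$ is the Kronecker product. For $T\ge0$ and integer $k$, $m(k,T)=\max\{m:\sum_{i=k}^m\gamma_i\le T\}$ (empty sums are zero). Conditions. A1: $\gamma_k>0$, $\gamma_k\to0$, $\sum_{k=1}^\infty\gamma_k=\infty$.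 A2: There is a continuously differentiable $v:\mathbb{R}^l\to\mathbb{R}$ with gradient $v_x$ such that (a) $\sup_{\delta\le d(x,J)\le\Delta}f^T(x)v_x(x)<0$ for any $\Delta>\delta>0$; (b) $v(J)=\{v(x):x\in J\}$ is nowhere dense; (c) $\|x^*\|<c_0$ and $v(x^* )<\inf_{\|x\|=c_0}v(x)$ for some positive constant $c_0$. A3: All $f_i$, $i\in\mathcal V$, are continuous. A4: (a) $W(k)$ is doubly stochastic for every $k\ge0$; (b) there is a constant $0<\eta<1$ with $\omega_{ij}(k)\ge\eta$ for all $j\in N_i(k)$, $i\in\mathcal V$, $k\ge0$; (c) the digraph $\mathcal G_\infty=\{\mathcal V,\mathcal E_\infty\}$ is strongly connected, where $\mathcal E_\infty=\{(j,i):(j,i)\in\mathcal E(k)\text{ for infinitely many }k\}$; (d) there is a positive integer $B$ such that $(j,i)\in\mathcal E(k)\cup\mathcal E(k+1)\cup\dots\cup\mathcal E(k+B-1)$ for all $(j,i)\in\mathcal E_\infty$ and all $k\ge0$. A5 (for the sample path $\omega$): for every $i\in\mathcal V$, (a) $\gamma_k\varepsilon_{i,k+1}\to0$ as $k\to\infty$; and (b) for any sufficiently large $K$, $$\lim_{T\to0}\limsup_{k\to\infty}\frac1T\Big\|\sum_{s=n_k}^{m(n_k,t_k)}\gamma_s\varepsilon_{i,s+1}I_{[\|x_{i,s}\|\le K]}\Big\|=0\quad\forall t_k\in[0,T]$$ along indices $\{n_k\}$ whenever $\{x_{i,n_k}\}$ converges. *)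

theory Defs
  imports "HOL-Probability.Probability"
begin

text \<open>
  The agents are the elements of a finite type \<open>'n\<close>, so \<open>N = CARD('n)\<close>; the state space is
  \<open>real ^ 'l\<close>. A stacked column vector is indexed by pairs (agent, coordinate).
\<close>

definition avg :: "('n::finite \<Rightarrow> real ^ 'l) \<Rightarrow> real ^ 'l" where
  "avg y = (1 / real CARD('n)) *\<^sub>R (\<Sum>i\<in>UNIV. y i)"

definition root_set :: "('n::finite \<Rightarrow> real ^ 'l \<Rightarrow> real ^ 'l) \<Rightarrow> (real ^ 'l) set" where
  "root_set f = {z. avg (\<lambda>i. f i z) = 0}"

definition col :: "('n::finite \<Rightarrow> real ^ 'l) \<Rightarrow> real ^ ('n \<times> 'l::finite)" where
  "col y = (\<chi> p. y (fst p) $ snd p)"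

definition kronecker ::
  "real ^ 'b ^ 'a \<Rightarrow> real ^ 'd ^ 'c \<Rightarrow> real ^ ('b \<times> 'd) ^ ('a::finite \<times> 'c::finite)"
  (infixl "\<otimes>\<^sub>K" 70) where
  "A \<otimes>\<^sub>K B = (\<chi> p q. A $ fst p $ fst q * B $ snd p $ snd q)"

definition D_perp :: "real ^ ('n::finite \<times> 'l::finite) ^ ('n \<times> 'l)" where
  "D_perp = (mat 1 - (1 / real CARD('n)) *\<^sub>R (\<chi> i j. 1 :: real ^ 'n ^ 'n)) \<otimes>\<^sub>K (mat 1 :: real ^ 'l ^ 'l)"

text \<open>An edge \<open>(j, i)\<close> means that \<open>i\<close> receives information from \<open>j\<close>.\<close>

definition nbrs :: "('n \<times> 'n) set \<Rightarrow> 'n \<Rightarrow> 'n set" where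
  "nbrs E i = {j. (j, i) \<in> E}"

definition adjacency_matrix :: "('n \<times> 'n) set \<Rightarrow> real ^ 'n ^ 'n \<Rightarrow> bool" where
  "adjacency_matrix E W \<longleftrightarrow> (\<forall>i j. W $ i $ j \<ge> 0) \<and> (\<forall>i j. W $ i $ j > 0 \<longleftrightarrow> (j, i) \<in> E)"

definition doubly_stochastic :: "real ^ 'n ^ 'n::finite \<Rightarrow> bool" where
  "doubly_stochastic W \<longleftrightarrow> (\<forall>i j. W $ i $ j \<ge> 0) \<and>
     (\<forall>i. (\<Sum>j\<in>UNIV. W $ i $ j) = 1) \<and> (\<forall>j. (\<Sum>i\<in>UNIV. W $ i $ j) = 1)"

definition strongly_connected :: "('n \<times> 'n) set \<Rightarrow> bool" where
  "strongly_connected E \<longleftrightarrow> (\<forall>i j. (i, j) \<in> E\<^sup>*)"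

definition persistent_edges :: "(nat \<Rightarrow> ('n \<times> 'n) set) \<Rightarrow> ('n \<times> 'n) set" where
  "persistent_edges E = {e. infinite {k. e \<in> E k}}"

text \<open>
  The algorithm along one sample path. \<open>Obs i (k + 1)\<close> is the observation of agent \<open>i\<close>
  at its state \<open>x i k\<close>, and \<open>\<sigma> i k\<close> is its truncation number; \<open>of_bool\<close> plays the
  role of the indicator.
\<close>

definition sigma_hat :: "('n::finite \<times> 'n) set \<Rightarrow> ('n \<Rightarrow> nat) \<Rightarrow> 'n \<Rightarrow> nat" where
  "sigma_hat E s i = Max (s ` nbrs E i)"

definition dsaawet ::
  "(nat \<Rightarrow> ('n::finite \<times> 'n) set) \<Rightarrow> (nat \<Rightarrow> real ^ 'n ^ 'n) \<Rightarrow> (nat \<Rightarrow> real) \<Rightarrow> real ^ 'l \<Rightarrow>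
   (nat \<Rightarrow> real) \<Rightarrow> ('n \<Rightarrow> nat \<Rightarrow> real ^ 'l) \<Rightarrow> ('n \<Rightarrow> nat \<Rightarrow> real ^ 'l) \<Rightarrow> ('n \<Rightarrow> nat \<Rightarrow> nat) \<Rightarrow> bool" where
  "dsaawet E W \<gamma> xstar M Obs x \<sigma> \<longleftrightarrow>
     (\<forall>i. \<sigma> i 0 = 0) \<and>
     (\<forall>k i. let
         sh = sigma_hat (E k) (\<lambda>j. \<sigma> j k) i;
         x' = of_bool (\<sigma> i k = sh) *\<^sub>R
                ((\<Sum>j\<in>nbrs (E k) i. W k $ i $ j *\<^sub>R
                    (of_bool (\<sigma> j k = sh) *\<^sub>R x j k + of_bool (\<sigma> j k < sh) *\<^sub>R xstar))
                 + \<gamma> k *\<^sub>R Obs i (k + 1))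
              + of_bool (\<sigma> i k < sh) *\<^sub>R xstar
       in x i (k + 1) = of_bool (norm x' > M sh) *\<^sub>R xstar + of_bool (norm x' \<le> M sh) *\<^sub>R x' \<and>
          \<sigma> i (k + 1) = sh + of_bool (norm x' > M sh))"

definition step_size_cond :: "(nat \<Rightarrow> real) \<Rightarrow> bool" where
  "step_size_cond \<gamma> \<longleftrightarrow> (\<forall>k. \<gamma> k > 0) \<and> \<gamma> \<longlonglongrightarrow> 0 \<and>
     filterlim (\<lambda>n. \<Sum>k=1..n. \<gamma> k) at_top sequentially"

text \<open>
  In the first clause the supremum is taken in the extended reals, so that it is \<open>-\<infinity>\<close> over an
  empty shell and \<open>\<infinity>\<close> for an unbounded family.
\<close>

definition lyapunov_cond ::
  "(real ^ 'l \<Rightarrow> real ^ 'l) \<Rightarrow> (real ^ 'l) set \<Rightarrow> real ^ 'l \<Rightarrow> bool" where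
  "lyapunov_cond g J xstar \<longleftrightarrow>
     (\<exists>v vx. (\<forall>z. GDERIV v z :> vx z) \<and> continuous_on UNIV vx \<and>
        (\<forall>\<delta> \<Delta>. 0 < \<delta> \<and> \<delta> < \<Delta> \<longrightarrow>
           (SUP z\<in>{z. \<delta> \<le> infdist z J \<and> infdist z J \<le> \<Delta>}. ereal (g z \<bullet> vx z)) < 0) \<and>
        interior (closure (v ` J)) = {} \<and>
        (\<exists>c\<^sub>0>0. norm xstar < c\<^sub>0 \<and> v xstar < (INF z\<in>sphere 0 c\<^sub>0. v z)))"

definition network_cond :: "(nat \<Rightarrow> ('n::finite \<times> 'n) set) \<Rightarrow> (nat \<Rightarrow> real ^ 'n ^ 'n) \<Rightarrow> bool" where
  "network_cond E W \<longleftrightarrow>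
     (\<forall>k. doubly_stochastic (W k)) \<and>
     (\<exists>\<eta>. 0 < \<eta> \<and> \<eta> < 1 \<and> (\<forall>k i. \<forall>j\<in>nbrs (E k) i. W k $ i $ j \<ge> \<eta>)) \<and>
     strongly_connected (persistent_edges E) \<and>
     (\<exists>B>0. \<forall>e\<in>persistent_edges E. \<forall>k. e \<in> (\<Union>s\<in>{k..<k + B}. E s))"

text \<open>
  \<open>m(k, T)\<close> is an integer: it equals \<open>k - 1\<close> (the empty sum), hence possibly \<open>-1\<close>,
  when \<open>\<gamma> k > T\<close>.
\<close>

definition horizon :: "(nat \<Rightarrow> real) \<Rightarrow> nat \<Rightarrow> real \<Rightarrow> int" where
  "horizon \<gamma> k T = (GREATEST m::int. (\<Sum>i | k \<le> i \<and> int i \<le> m. \<gamma> i) \<le> T)"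

text \<open>
  The limit is asserted for every choice of the numbers \<open>t\<^sub>k \<in> [0, T]\<close>, which may vary
  with \<open>T\<close>; the upper limit is taken in the extended reals.
\<close>

definition noise_cond ::
  "(nat \<Rightarrow> real) \<Rightarrow> ('n \<Rightarrow> nat \<Rightarrow> real ^ 'l) \<Rightarrow> ('n \<Rightarrow> nat \<Rightarrow> real ^ 'l) \<Rightarrow> bool" where
  "noise_cond \<gamma> x \<epsilon> \<longleftrightarrow> (\<forall>i.
     (\<lambda>k. \<gamma> k *\<^sub>R \<epsilon> i (k + 1)) \<longlonglongrightarrow> 0 \<and>
     (\<forall>\<^sub>F K in at_top. \<forall>n. strict_mono n \<and> convergent (\<lambda>k. x i (n k)) \<longrightarrow>
        (\<forall>t. (\<forall>T>0. \<forall>k. t T k \<in> {0..T}) \<longrightarrow>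
           ((\<lambda>T. limsup (\<lambda>k. ereal (1 / T * norm
               (\<Sum>s | n k \<le> s \<and> int s \<le> horizon \<gamma> (n k) (t T k).
                  \<gamma> s *\<^sub>R of_bool (norm (x i s) \<le> K) *\<^sub>R \<epsilon> i (s + 1)))))
            \<longlongrightarrow> 0) (at_right (0::real)))))"

end

(* Along the fixed path, call an agent leading if its truncation number is the current maximum,
   and freeze the lagging agents at xstar. Between two increments of the maximum ("resets") the
   modified states start at xstar, stay close to each other (products of L consecutive weight
   matrices have entries bounded below by eta^L, and gamma_k times the noise tends to 0), and their
   average follows the flow of the mean field up to noise that A5 makes negligible on short time
   windows. Hence v of the average cannot cross an interval [d1, d2] with d1 outside v(J) upwards
   infinitely often with vanishing disagreement. A reset forces the average to leave the ball of
   radius c0, i.e. such a crossing, so there are only finitely many resets. Afterwards the recursion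
   is the untruncated one, the same crossing argument makes v converge along the averages, and a
   limit point outside J would make v drop by a fixed amount infinitely often. The limit set is
   connected because the increments vanish. *)

theory Submission
  imports Defs
begin

section \<open>Consensus under doubly stochastic weights\<close>

text \<open>The shape of the proof is dictated by the noise condition. It controls the noise of one
  agent at a time, only along indices at which the true state of that agent converges, and only
  relative to the length of short windows. Resets, on the other hand, are described through the
  modified states \<open>y\<close>, and the noise bound can be exploited only where \<open>y\<close>
  and the true states \<open>x\<close> coincide, that is, where every agent leads. Both views meet
  on the crossing interval: it begins at the last time at which v of the average is at most
  \<open>\<delta>1\<close>, and from then on no agent can lag without dragging the average back to
  \<open>xstar\<close>. For this the disagreement must be small at once after a reset and not merely
  in the long run, although the agents then still have different truncation numbers; hence the
  explicit bound \<open>4 * real L / \<eta> ^ L * \<beta>\<close>, which a block of L steps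
  reproduces. One spreading argument on graphs is used twice: for the entries of the weight products
  and for the leading status.\<close>

lemma reach_all:
  fixes E :: "nat \<Rightarrow> ('n::finite \<times> 'n) set" and R :: "nat \<Rightarrow> 'n set"
  assumes conn: "strongly_connected P"
    and recur: "\<And>e k. e \<in> P \<Longrightarrow> e \<in> (\<Union>s\<in>{k..<k + B}. E s)"
    and self: "\<And>k i. (i, i) \<in> E k"
    and ne: "R n \<noteq> {}"
    and step: "\<And>k i j. n \<le> k \<Longrightarrow> k < n + B * CARD('n) \<Longrightarrow> j \<in> R k \<Longrightarrow> (j, i) \<in> E k \<Longrightarrow> i \<in> R (Suc k)"
  shows "R (n + B * CARD('n)) = UNIV"
proof -
  have mono: "R k \<subseteq> R k'" if "n \<le> k" "k \<le> k'" "k' \<le> n + B * CARD('n)" for k k'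
    using that(2,3)
  proof (induction k' rule: dec_induct)
    case (step m)
    have "R m \<subseteq> R (Suc m)"
      using assms(5)[of m] self[of _ m] step that(1) by auto
    then show ?case using step by auto
  qed simp
  \<comment> \<open>Each block of B steps reaches one more agent: a path of persistent edges from a
    reached agent to an unreached one leaves the reached set somewhere, and that edge is active
    within the block.\<close>
  have "card (R (n + B * c)) \<ge> min (Suc c) CARD('n)" if "c \<le> CARD('n)" for c
    using that
  proof (induction c)
    case 0
    have "card (R n) > 0" using ne by (simp add: card_gt_0_iff)
    then show ?case by simp
  next
    case (Suc c)
    define k k' where "k = n + B * c" and "k' = n + B * Suc c"
    have k: "n \<le> k" "k \<le> k'" "k' = k + B" by (auto simp: k_def k'_def)
    have k'L: "k' \<le> n + B * CARD('n)"
      unfolding k'_def using Suc.prems by (intro add_left_mono mult_le_mono2)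
    have sub: "R k \<subseteq> R k'" using mono k k'L by blast
    show ?case
    proof (cases "R k = UNIV")
      case True
      then have "R k' = UNIV" using sub by auto
      then show ?thesis unfolding k'_def by simp
    next
      case False
      have kne: "R k \<noteq> {}" using mono[of n k] ne k k'L by auto
      then obtain a b where a: "a \<in> R k" and b: "b \<notin> R k" using False by auto
      have "(a, b) \<in> P\<^sup>*" using conn by (auto simp: strongly_connected_def)
      then have "b \<in> R k \<or> (\<exists>j i. j \<in> R k \<and> i \<notin> R k \<and> (j, i) \<in> P)"
        by (induction rule: rtrancl_induct) (use a in auto)
      then obtain i j where ij: "j \<in> R k" "i \<notin> R k" "(j, i) \<in> P" using b by auto
      obtain s where s: "k \<le> s" "s < k + B" "(j, i) \<in> E s" using recur[OF ij(3), of k] by auto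
      have "j \<in> R s" using mono[of k s] ij s k k'L by auto
      then have "i \<in> R (Suc s)" using assms(5)[of s j i] s k k'L by auto
      then have "i \<in> R k'" using mono[of "Suc s" k'] s k k'L by auto
      then have "R k \<subset> R k'" using sub ij by auto
      then have "card (R k) < card (R k')" by (intro psubset_card_mono) auto
      then show ?thesis using Suc.IH Suc.prems unfolding k_def k'_def by auto
    qed
  qed
  from this[of "CARD('n)"] have "card (R (n + B * CARD('n))) \<ge> CARD('n)" by simp
  then show ?thesis by (meson card_seteq finite subset_UNIV)
qed

text \<open>Since both weight families have mass c, c times the difference is the sum over all pairs
  of \<open>a j * b k\<close> times \<open>y j - y k\<close>, of total weight \<open>c * c\<close>.
  For c below 1 this contracts the spread.\<close>

lemma norm_diff_weighted_sums_le:
  fixes y :: "'n::finite \<Rightarrow> 'a::real_normed_vector"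
  assumes a: "\<And>j. a j \<ge> 0" "(\<Sum>j\<in>UNIV. a j) = c"
    and b: "\<And>j. b j \<ge> 0" "(\<Sum>j\<in>UNIV. b j) = c"
    and d: "\<And>i j. norm (y i - y j) \<le> d"
  shows "norm ((\<Sum>j\<in>UNIV. a j *\<^sub>R y j) - (\<Sum>j\<in>UNIV. b j *\<^sub>R y j)) \<le> c * d"
proof (cases "c = 0")
  case True
  have "a j = 0" "b j = 0" for j
    using a b True sum_nonneg_eq_0_iff[of UNIV a] sum_nonneg_eq_0_iff[of UNIV b] by auto
  then show ?thesis using True by simp
next
  case False
  have c: "c > 0" using False a sum_nonneg[of UNIV a] by auto
  have "c *\<^sub>R ((\<Sum>j\<in>UNIV. a j *\<^sub>R y j) - (\<Sum>j\<in>UNIV. b j *\<^sub>R y j)) =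
      (\<Sum>j\<in>UNIV. \<Sum>k\<in>UNIV. (a j * b k) *\<^sub>R (y j - y k))" (is "?l = ?r")
  proof -
    have "?r = (\<Sum>j\<in>UNIV. \<Sum>k\<in>UNIV. (a j * b k) *\<^sub>R y j) - (\<Sum>j\<in>UNIV. \<Sum>k\<in>UNIV. (a j * b k) *\<^sub>R y k)"
      by (simp add: scaleR_diff_right sum_subtractf)
    also have "(\<Sum>j\<in>UNIV. \<Sum>k\<in>UNIV. (a j * b k) *\<^sub>R y j) = c *\<^sub>R (\<Sum>j\<in>UNIV. a j *\<^sub>R y j)"
      by (simp add: scaleR_sum_left[symmetric] sum_distrib_left[symmetric] b scaleR_sum_right mult.commute)
    also have "(\<Sum>j\<in>UNIV. \<Sum>k\<in>UNIV. (a j * b k) *\<^sub>R y k) = c *\<^sub>R (\<Sum>k\<in>UNIV. b k *\<^sub>R y k)"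
      by (subst sum.swap)
         (simp add: scaleR_sum_left[symmetric] sum_distrib_right[symmetric] a scaleR_sum_right)
    finally show ?thesis by (simp add: scaleR_diff_right)
  qed
  then have "norm ?l \<le> (\<Sum>j\<in>UNIV. \<Sum>k\<in>UNIV. (a j * b k) * d)"
    by (auto intro!: sum_norm_le mult_left_mono simp: a b d)
  also have "\<dots> = c * (c * d)"
    by (simp add: sum_distrib_right[symmetric] sum_distrib_left[symmetric] a b)
  finally have "c * norm ((\<Sum>j\<in>UNIV. a j *\<^sub>R y j) - (\<Sum>j\<in>UNIV. b j *\<^sub>R y j)) \<le> c * (c * d)"
    using c by simp
  then show ?thesis using c by simp
qed

lemma norm_convex_sum_le:
  fixes y :: "'n::finite \<Rightarrow> 'a::real_normed_vector"
  assumes "\<And>j. a j \<ge> 0" "(\<Sum>j\<in>UNIV. a j) = 1" "\<And>j. norm (y j - z) \<le> r"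
  shows "norm ((\<Sum>j\<in>UNIV. a j *\<^sub>R y j) - z) \<le> r"
proof -
  have "(\<Sum>j\<in>UNIV. a j *\<^sub>R y j) - z = (\<Sum>j\<in>UNIV. a j *\<^sub>R (y j - z))"
    using assms(2) by (simp add: scaleR_diff_right sum_subtractf scaleR_sum_left[symmetric])
  also have "norm \<dots> \<le> (\<Sum>j\<in>UNIV. a j * r)"
    by (rule sum_norm_le) (simp add: assms mult_left_mono)
  also have "\<dots> = r" using assms(2) by (simp add: sum_distrib_right[symmetric])
  finally show ?thesis .
qed

section \<open>Products of consecutive weight matrices\<close>

fun transition :: "(nat \<Rightarrow> real ^ 'n ^ 'n) \<Rightarrow> nat \<Rightarrow> nat \<Rightarrow> real ^ 'n ^ 'n::finite" where
  "transition W n 0 = mat 1"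
| "transition W n (Suc t) = W (n + t) ** transition W n t"

lemma transition_stochastic:
  assumes "\<And>k. doubly_stochastic (W k)"
  shows "transition W n t $ i $ j \<ge> 0" and "(\<Sum>j\<in>UNIV. transition W n t $ i $ j) = 1"
proof -
  show "transition W n t $ i $ j \<ge> 0"
    using assms by (induction t arbitrary: i)
      (auto simp: mat_def matrix_matrix_mult_def doubly_stochastic_def intro!: sum_nonneg)
  show "(\<Sum>j\<in>UNIV. transition W n t $ i $ j) = 1"
  proof (induction t arbitrary: i)
    case 0
    then show ?case by (simp add: mat_def)
  next
    case (Suc t)
    have "(\<Sum>j\<in>UNIV. transition W n (Suc t) $ i $ j) =
        (\<Sum>m\<in>UNIV. W (n + t) $ i $ m * (\<Sum>j\<in>UNIV. transition W n t $ m $ j))"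
      by (simp add: matrix_matrix_mult_def sum_distrib_left) (rule sum.swap)
    then show ?case using assms Suc by (simp add: doubly_stochastic_def)
  qed
qed

text \<open>Averaging with nonnegative rows of sum one never enlarges an error, so the errors of t
  steps only add up.\<close>

lemma transition_recursion:
  fixes y :: "'n::finite \<Rightarrow> nat \<Rightarrow> 'a::real_normed_vector"
  assumes W: "\<And>k. doubly_stochastic (W k)"
    and step: "\<And>k i. n \<le> k \<Longrightarrow> k < n + t \<Longrightarrow>
      norm (y i (Suc k) - (\<Sum>j\<in>UNIV. W k $ i $ j *\<^sub>R y j k)) \<le> \<beta>"
  shows "norm (y i (n + t) - (\<Sum>j\<in>UNIV. transition W n t $ i $ j *\<^sub>R y j n)) \<le> real t * \<beta>"
  using step
proof (induction t arbitrary: i)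
  case 0
  have "(\<Sum>j\<in>UNIV. mat 1 $ i $ j *\<^sub>R y j n) = (\<Sum>j\<in>UNIV. if j = i then y j n else 0)"
    by (rule sum.cong) (auto simp: mat_def)
  then show ?case by simp
next
  case (Suc t)
  have IH: "norm (y i (n + t) - (\<Sum>j\<in>UNIV. transition W n t $ i $ j *\<^sub>R y j n)) \<le> real t * \<beta>" for i
    using Suc by simp
  have eq: "(\<Sum>j\<in>UNIV. transition W n (Suc t) $ i $ j *\<^sub>R y j n) =
      (\<Sum>m\<in>UNIV. W (n + t) $ i $ m *\<^sub>R (\<Sum>j\<in>UNIV. transition W n t $ m $ j *\<^sub>R y j n))"
    by (simp add: matrix_matrix_mult_def scaleR_sum_left scaleR_sum_right) (rule sum.swap)
  have "norm ((\<Sum>m\<in>UNIV. W (n + t) $ i $ m *\<^sub>R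
      (y m (n + t) - (\<Sum>j\<in>UNIV. transition W n t $ m $ j *\<^sub>R y j n))) - 0) \<le> real t * \<beta>"
    using W[of "n+t"] IH by (intro norm_convex_sum_le) (auto simp: doubly_stochastic_def)
  then have "norm ((\<Sum>m\<in>UNIV. W (n + t) $ i $ m *\<^sub>R y m (n + t)) -
      (\<Sum>j\<in>UNIV. transition W n (Suc t) $ i $ j *\<^sub>R y j n)) \<le> real t * \<beta>"
    unfolding eq by (simp add: scaleR_diff_right sum_subtractf)
  moreover have "norm (y i (Suc (n + t)) - (\<Sum>j\<in>UNIV. W (n + t) $ i $ j *\<^sub>R y j (n + t))) \<le> \<beta>"
    using Suc.prems[of "n + t"] by simp
  ultimately show ?case
    using norm_triangle_le[of "y i (Suc (n + t)) - (\<Sum>j\<in>UNIV. W (n + t) $ i $ j *\<^sub>R y j (n + t))"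
        "(\<Sum>m\<in>UNIV. W (n + t) $ i $ m *\<^sub>R y m (n + t)) -
      (\<Sum>j\<in>UNIV. transition W n (Suc t) $ i $ j *\<^sub>R y j n)" "\<beta> + real t * \<beta>"]
    by (simp add: algebra_simps)
qed

locale network =
  fixes E :: "nat \<Rightarrow> ('n::finite \<times> 'n) set" and W :: "nat \<Rightarrow> real ^ 'n ^ 'n"
    and \<eta> :: real and B :: nat
  assumes adjacency: "adjacency_matrix (E k) (W k)"
    and self_loop: "i \<in> nbrs (E k) i"
    and stochastic: "doubly_stochastic (W k)"
    and eta: "0 < \<eta>" "\<eta> < 1"
    and weight_ge: "j \<in> nbrs (E k) i \<Longrightarrow> W k $ i $ j \<ge> \<eta>"
    and connected_graph: "strongly_connected (persistent_edges E)"
    and recurrent: "e \<in> persistent_edges E \<Longrightarrow> e \<in> (\<Union>s\<in>{k..<k + B}. E s)"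
    and B_pos: "B > 0"
begin

text \<open>A time within which information from any agent reaches every other one: at most
  \<open>CARD('n)\<close> hops, each within B steps.\<close>

definition L where "L = B * CARD('n)"

lemma L_pos: "L > 0"
  using B_pos by (simp add: L_def)

lemma weight_nonneg: "W k $ i $ j \<ge> 0" and row_sum: "(\<Sum>j\<in>UNIV. W k $ i $ j) = 1"
  and column_sum: "(\<Sum>i\<in>UNIV. W k $ i $ j) = 1"
  using stochastic[of k] by (auto simp: doubly_stochastic_def)

lemma sum_nbrs: "(\<Sum>j\<in>nbrs (E k) i. W k $ i $ j *\<^sub>R (y j :: 'a::real_vector)) = (\<Sum>j\<in>UNIV. W k $ i $ j *\<^sub>R y j)"
proof (rule sum.mono_neutral_left)
  show "\<forall>j\<in>UNIV - nbrs (E k) i. W k $ i $ j *\<^sub>R y j = 0"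
    using adjacency[of k] by (auto simp: adjacency_matrix_def nbrs_def not_less order_eq_iff)
      (metis order.antisym not_le)
qed auto

lemma spread_everywhere:
  assumes "R n \<noteq> {}"
    and "\<And>k i j. n \<le> k \<Longrightarrow> k < n + L \<Longrightarrow> j \<in> R k \<Longrightarrow> (j, i) \<in> E k \<Longrightarrow> i \<in> R (Suc k)"
  shows "R (n + L) = UNIV"
  unfolding L_def
  by (rule reach_all[OF connected_graph recurrent])
     (use self_loop assms in \<open>auto simp: nbrs_def L_def\<close>)

text \<open>The agents whose entry in column j is at least eta to the power of the elapsed time form
  a set that grows along edges, because every edge carries a weight of at least eta.\<close>

lemma transition_ge: "transition W n L $ i $ j \<ge> \<eta> ^ L"
proof -
  define R where "R = (\<lambda>k. {i. transition W n (k - n) $ i $ j \<ge> \<eta> ^ (k - n)})"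
  have "R (n + L) = UNIV"
  proof (rule spread_everywhere)
    have "j \<in> R n" by (simp add: R_def mat_def)
    then show "R n \<noteq> {}" by auto
    fix k i j' assume k: "n \<le> k" and j': "j' \<in> R k" "(j', i) \<in> E k"
    define t where "t = k - n"
    have kt: "k = n + t" "Suc k - n = Suc t" using k by (auto simp: t_def)
    have "\<eta> * \<eta> ^ t \<le> W k $ i $ j' * transition W n t $ j' $ j"
      using j' weight_ge[of j' k i] eta by (intro mult_mono) (auto simp: R_def nbrs_def kt)
    also have "\<dots> \<le> (\<Sum>m\<in>UNIV. W k $ i $ m * transition W n t $ m $ j)"
      using weight_nonneg transition_stochastic(1)[of W, OF stochastic]
      by (intro member_le_sum) auto
    finally show "i \<in> R (Suc k)"
      unfolding R_def kt(2) mem_Collect_eq by (simp add: matrix_matrix_mult_def kt(1))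
  qed
  then show ?thesis by (auto simp: R_def)
qed

text \<open>Doeblin's argument: every row of the L-step product puts at least
  \<open>\<eta> ^ L\<close> on one common column. This share cancels in the difference of two rows
  and leaves two weight vectors of equal mass \<open>1 - \<eta> ^ L\<close>. The last term is the
  error of L steps for each of two agents.\<close>

lemma spread_contracts:
  fixes y :: "'n \<Rightarrow> nat \<Rightarrow> 'a::real_normed_vector"
  assumes step: "\<And>k i. n \<le> k \<Longrightarrow> k < n + L \<Longrightarrow>
      norm (y i (Suc k) - (\<Sum>j\<in>UNIV. W k $ i $ j *\<^sub>R y j k)) \<le> \<beta>"
    and d: "\<And>i j. norm (y i n - y j n) \<le> d"
  shows "norm (y i (n + L) - y j (n + L)) \<le> (1 - \<eta> ^ L) * d + 2 * real L * \<beta>"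
proof -
  \<comment> \<open>\<open>undefined\<close> is just some agent, picked as the common
    column.\<close>
  let ?T = "transition W n L" and ?m = "undefined :: 'n"
  define a where "a = (\<lambda>i m. ?T $ i $ m - (if m = ?m then \<eta> ^ L else 0))"
  have a0: "a i m \<ge> 0" for i m
    using transition_ge[of n i m] transition_stochastic(1)[of W n L i m, OF stochastic] by (auto simp: a_def)
  have a1: "(\<Sum>m\<in>UNIV. a i m) = 1 - \<eta> ^ L" for i
    using transition_stochastic(2)[of W n L i, OF stochastic] by (simp add: a_def sum_subtractf)
  have eq: "(\<Sum>m\<in>UNIV. ?T $ i $ m *\<^sub>R y m n) = (\<Sum>m\<in>UNIV. a i m *\<^sub>R y m n) + \<eta> ^ L *\<^sub>R y ?m n" for i
  proof -
    have "(\<Sum>m\<in>UNIV. a i m *\<^sub>R y m n) =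
        (\<Sum>m\<in>UNIV. ?T $ i $ m *\<^sub>R y m n) - (\<Sum>m\<in>UNIV. if m = ?m then \<eta> ^ L *\<^sub>R y m n else 0)"
      unfolding sum_subtractf[symmetric] by (rule sum.cong) (auto simp: a_def algebra_simps)
    then show ?thesis by simp
  qed
  let ?u = "\<lambda>i. \<Sum>m\<in>UNIV. ?T $ i $ m *\<^sub>R y m n"
  have "norm (?u i - ?u j) \<le> (1 - \<eta> ^ L) * d"
    using norm_diff_weighted_sums_le[of "a i" "1 - \<eta> ^ L" "a j" "\<lambda>m. y m n", OF a0 a1 a0 a1 d]
    unfolding eq by simp
  moreover have "norm (y i (n + L) - ?u i) \<le> real L * \<beta>" for i
    by (rule transition_recursion[of W, OF stochastic step])
  from this[of i] this[of j] have "norm ((y i (n + L) - ?u i) - (y j (n + L) - ?u j)) \<le> 2 * real L * \<beta>"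
    by (intro norm_triangle_le_diff) simp
  ultimately show ?thesis
    using norm_triangle_le[of "?u i - ?u j" "(y i (n + L) - ?u i) - (y j (n + L) - ?u j)"
      "(1 - \<eta> ^ L) * d + 2 * real L * \<beta>"]
    by (simp add: algebra_simps)
qed

lemma spread_tendsto_0:
  fixes y :: "'n \<Rightarrow> nat \<Rightarrow> 'a::real_normed_vector"
  assumes bdd: "\<And>i k. k \<ge> k0 \<Longrightarrow> norm (y i k) \<le> R"
    and step: "\<And>k i. k \<ge> k0 \<Longrightarrow> norm (y i (Suc k) - (\<Sum>j\<in>UNIV. W k $ i $ j *\<^sub>R y j k)) \<le> b k"
    and b: "b \<longlonglongrightarrow> 0" and e: "e > 0"
  shows "\<forall>\<^sub>F k in sequentially. \<forall>i j. norm (y i k - y j k) \<le> e"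
proof -
  define \<alpha> where "\<alpha> = \<eta> ^ L"
  have \<alpha>: "0 < \<alpha>" "\<alpha> < 1"
    using eta L_pos power_Suc_less_one[of \<eta> "L - 1"] by (auto simp: \<alpha>_def)
  \<comment> \<open>Chosen so that e / 2 is the fixed point of the map taking d to
    \<open>(1 - \<alpha>) * d + 2 * real L * \<beta>\<close>; a block of L steps then shrinks the
    excess over e / 2 by the factor \<open>1 - \<alpha>\<close>.\<close>
  define \<beta> where "\<beta> = \<alpha> * (e / 2) / (2 * real L)"
  have \<beta>: "\<beta> > 0" "2 * real L * \<beta> = \<alpha> * (e / 2)" using \<alpha> e L_pos by (auto simp: \<beta>_def)
  obtain N where N: "\<And>k. k \<ge> N \<Longrightarrow> b k < \<beta>"
    using order_tendstoD(2)[OF b \<beta>(1)] by (auto simp: eventually_sequentially)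
  have "\<exists>K. \<forall>k\<ge>K. \<forall>i j. norm (y i k - y j k) \<le> (1 - \<alpha>) ^ q * (2 * R) + e / 2" for q
  proof (induction q)
    case 0
    have "norm (y i k - y j k) \<le> 2 * R + e / 2" if "k \<ge> k0" for i j k
      using norm_triangle_ineq4[of "y i k" "y j k"] bdd[OF that, of i] bdd[OF that, of j] e by simp
    then show ?case by auto
  next
    case (Suc q)
    then obtain K where K: "\<And>k i j. k \<ge> K \<Longrightarrow> norm (y i k - y j k) \<le> (1 - \<alpha>) ^ q * (2 * R) + e / 2"
      by auto
    have "norm (y i k - y j k) \<le> (1 - \<alpha>) ^ Suc q * (2 * R) + e / 2" if k: "k \<ge> K + k0 + N + L" for i j k
    proof -
      \<comment> \<open>Looking back L steps from an arbitrary late k, rather than moving along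
        multiples of L, yields the bound at all late times.\<close>
      define n where "n = k - L"
      have n: "n \<ge> K" "n \<ge> k0" "n \<ge> N" "k = n + L" using k by (auto simp: n_def)
      have "norm (y i (n + L) - y j (n + L)) \<le>
          (1 - \<eta> ^ L) * ((1 - \<alpha>) ^ q * (2 * R) + e / 2) + 2 * real L * \<beta>"
      proof (rule spread_contracts)
        show "norm (y i (Suc k) - (\<Sum>j\<in>UNIV. W k $ i $ j *\<^sub>R y j k)) \<le> \<beta>" if "n \<le> k" for k i
          using step[of k i] N[of k] n that by simp
      qed (use K n in auto)
      then show ?thesis unfolding \<beta>(2) n(4) \<alpha>_def[symmetric] by (simp add: algebra_simps diff_divide_distrib)
    qed
    then show ?case by blast
  qed
  moreover have "(\<lambda>q. (1 - \<alpha>) ^ q * (2 * R)) \<longlonglongrightarrow> 0"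
    using \<alpha> by (intro tendsto_mult_left_zero LIMSEQ_power_zero) auto
  then have "\<forall>\<^sub>F q in sequentially. (1 - \<alpha>) ^ q * (2 * R) < e / 2"
    using e by (intro order_tendstoD) auto
  then obtain q where "(1 - \<alpha>) ^ q * (2 * R) < e / 2" by (auto simp: eventually_sequentially)
  ultimately show ?thesis unfolding eventually_sequentially
    by (smt (verit, ccfv_threshold) field_sum_of_halves)
qed

end

section \<open>Descent of the Lyapunov function\<close>

text \<open>Lets the noise condition be read for any window ending just before s: as the steps are
  positive, including the step s would overrun the budget. For s = n the window is empty and the
  value is n - 1.\<close>

lemma horizon_sum:
  assumes pos: "\<And>k. \<gamma> k > 0" and "n \<le> s"
  shows "horizon \<gamma> n (\<Sum>r\<in>{n..<s}. \<gamma> r) = int s - 1"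
  unfolding horizon_def
proof (rule Greatest_equality)
  have "{i. n \<le> i \<and> int i \<le> int s - 1} = {n..<s}" by auto
  then show "(\<Sum>i | n \<le> i \<and> int i \<le> int s - 1. \<gamma> i) \<le> (\<Sum>r\<in>{n..<s}. \<gamma> r)" by simp
  fix m :: int
  assume le: "(\<Sum>i | n \<le> i \<and> int i \<le> m. \<gamma> i) \<le> (\<Sum>r\<in>{n..<s}. \<gamma> r)"
  show "m \<le> int s - 1"
  proof (rule ccontr)
    assume "\<not> ?thesis"
    then have m: "m \<ge> int s" by simp
    have fin: "finite {i. n \<le> i \<and> int i \<le> m}"
      by (rule finite_subset[of _ "{..nat m}"]) auto
    have "(\<Sum>r\<in>{n..<s}. \<gamma> r) < (\<Sum>r\<in>insert s {n..<s}. \<gamma> r)" using pos by simp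
    also have "\<dots> \<le> (\<Sum>i | n \<le> i \<and> int i \<le> m. \<gamma> i)"
      using m \<open>n \<le> s\<close> pos by (intro sum_mono2 fin) (auto simp: less_imp_le)
    finally show False using le by simp
  qed
qed

text \<open>Take the last index whose elapsed time is at most T: the next step overruns T and is
  shorter than T / 2, so at least T / 2 has elapsed. This lower bound turns a rate of decrease into
  a definite decrease.\<close>

lemma half_step_exists:
  fixes \<gamma> :: "nat \<Rightarrow> real"
  assumes "n \<le> b" "(\<Sum>r\<in>{n..<b}. \<gamma> r) > T" "T > 0" "\<And>r. r \<ge> n \<Longrightarrow> \<gamma> r < T / 2"
  shows "\<exists>s. n < s \<and> s < b \<and> T / 2 \<le> (\<Sum>r\<in>{n..<s}. \<gamma> r) \<and> (\<Sum>r\<in>{n..<s}. \<gamma> r) \<le> T"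
proof -
  define A where "A = {s\<in>{n..b}. (\<Sum>r\<in>{n..<s}. \<gamma> r) \<le> T}"
  have A: "finite A" "n \<in> A" using assms by (auto simp: A_def)
  define s where "s = Max A"
  have sA: "s \<in> A" unfolding s_def using A by (intro Max_in) auto
  have sb: "s < b" using sA assms(2) by (cases "s = b") (auto simp: A_def)
  have "Suc s \<notin> A" using Max_ge[OF A(1), of "Suc s"] by (fold s_def) auto
  then have "(\<Sum>r\<in>{n..<Suc s}. \<gamma> r) > T" using sA sb by (auto simp: A_def)
  moreover have "(\<Sum>r\<in>{n..<Suc s}. \<gamma> r) = (\<Sum>r\<in>{n..<s}. \<gamma> r) + \<gamma> s"
    using sA by (simp add: A_def)
  moreover have "\<gamma> s < T / 2" using assms(4) sA by (auto simp: A_def)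
  ultimately have half: "T / 2 \<le> (\<Sum>r\<in>{n..<s}. \<gamma> r)" by linarith
  then have "n < s" using sA assms(3) by (cases "n = s") (auto simp: A_def)
  then show ?thesis using half sA sb by (auto simp: A_def)
qed

section \<open>Averages over the agents and uniform bounds on balls\<close>

lemma avg_alt: "avg y = (\<Sum>j\<in>UNIV. (1 / real CARD('n)) *\<^sub>R y j)"
  for y :: "'n::finite \<Rightarrow> real ^ 'l"
  by (simp add: avg_def scaleR_sum_right)

lemma avg_add: "avg (\<lambda>i. y i + z i) = avg y + avg z"
  by (simp add: avg_def sum.distrib scaleR_add_right)

lemma avg_scaleR: "avg (\<lambda>i. c *\<^sub>R y i) = c *\<^sub>R avg y"
  by (simp add: avg_def scaleR_sum_right mult.commute)

lemma norm_avg_diff_le: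
  fixes y :: "'n::finite \<Rightarrow> real ^ 'l"
  assumes "\<And>j. norm (y j - z) \<le> r"
  shows "norm (avg y - z) \<le> r"
  unfolding avg_alt by (rule norm_convex_sum_le) (use assms in auto)

lemma norm_avg_le:
  fixes y :: "'n::finite \<Rightarrow> real ^ 'l"
  assumes "\<And>j. norm (y j) \<le> r"
  shows "norm (avg y) \<le> r"
  using norm_avg_diff_le[of y 0 r] assms by simp

lemma bounded_on_cball:
  fixes f :: "'n::finite \<Rightarrow> 'a::euclidean_space \<Rightarrow> 'b::real_normed_vector"
  assumes "\<And>i. continuous_on UNIV (f i)"
  obtains F where "F \<ge> 0" "\<And>i z. norm z \<le> R \<Longrightarrow> norm (f i z) \<le> F"
proof -
  have "\<exists>F. \<forall>z\<in>cball 0 R. norm (f i z) \<le> F" for i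
  proof -
    have "compact (f i ` cball 0 R)"
      by (intro compact_continuous_image continuous_on_subset[OF assms]) auto
    from compact_imp_bounded[OF this] show ?thesis by (simp add: bounded_iff)
  qed
  then obtain G where G: "\<And>i z. z \<in> cball 0 R \<Longrightarrow> norm (f i z) \<le> G i" by metis
  show ?thesis
  proof
    show "(\<Sum>i\<in>UNIV. \<bar>G i\<bar>) \<ge> 0" by (simp add: sum_nonneg)
    fix i z assume "norm (z :: 'a) \<le> R"
    then have "norm (f i z) \<le> \<bar>G i\<bar>" using G[of z i] by simp
    also have "\<dots> \<le> (\<Sum>i\<in>UNIV. \<bar>G i\<bar>)" by (rule member_le_sum) auto
    finally show "norm (f i z) \<le> (\<Sum>i\<in>UNIV. \<bar>G i\<bar>)" .
  qed
qed

text \<open>Truncation is absent from this locale, and the recursion is not assumed at all times. It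
  enters through windows on which it happens to hold, so the same estimates serve between resets and
  after the last one.\<close>

locale approximation_path = network E W \<eta> B
  for E :: "nat \<Rightarrow> ('n::finite \<times> 'n) set" and W and \<eta> and B +
  fixes f :: "'n \<Rightarrow> real ^ 'l::finite \<Rightarrow> real ^ 'l" and \<gamma> :: "nat \<Rightarrow> real"
    and x \<epsilon> :: "'n \<Rightarrow> nat \<Rightarrow> real ^ 'l"
    and v :: "real ^ 'l \<Rightarrow> real" and vx :: "real ^ 'l \<Rightarrow> real ^ 'l"
  assumes step_size: "step_size_cond \<gamma>"
    and f_cont: "\<And>i. continuous_on UNIV (f i)"
    and noise: "noise_cond \<gamma> x \<epsilon>"
    and gradient: "\<And>z. GDERIV v z :> vx z"
    and vx_cont: "continuous_on UNIV vx"
    and decrease: "\<And>z. z \<notin> root_set f \<Longrightarrow> avg (\<lambda>i. f i z) \<bullet> vx z < 0"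
begin

section \<open>Noise and drift on short time windows\<close>

lemma gamma_pos: "\<gamma> k > 0" and gamma_0: "\<gamma> \<longlonglongrightarrow> 0"
  and gamma_sum: "filterlim (\<lambda>n. \<Sum>k=1..n. \<gamma> k) at_top sequentially"
  using step_size by (auto simp: step_size_cond_def)

lemma noise_vanishes: "(\<lambda>k. \<gamma> k *\<^sub>R \<epsilon> i (Suc k)) \<longlonglongrightarrow> 0"
  using noise by (auto simp: noise_cond_def)

lemma v_cont: "continuous_on UNIV v"
  using gradient by (auto simp: gderiv_def intro!: continuous_at_imp_continuous_on has_derivative_continuous)

definition xb where "xb k = avg (\<lambda>i. x i k)"

definition regular_step where
  "regular_step k \<longleftrightarrow> (\<forall>i. x i (Suc k) =
     (\<Sum>j\<in>UNIV. W k $ i $ j *\<^sub>R x j k) + \<gamma> k *\<^sub>R (f i (x i k) + \<epsilon> i (Suc k)))"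

text \<open>The bound R makes the indicators of the noise condition equal to 1 once K is at least R.
  The bound d will tend to 0 along sequences of windows. The step that leaves b may be
  irregular.\<close>

definition tracked where
  "tracked R d n b \<longleftrightarrow> n \<le> b \<and> (\<forall>s\<in>{n..<b}. regular_step s) \<and>
     (\<forall>s\<in>{n..b}. \<forall>i. norm (x i s) \<le> R) \<and> (\<forall>s\<in>{n..b}. \<forall>i j. norm (x i s - x j s) \<le> d)"

lemma norm_x_minus_xb:
  assumes "\<And>i j. norm (x i s - x j s) \<le> d"
  shows "norm (x i s - xb s) \<le> d"
  using norm_avg_diff_le[of "\<lambda>j. x j s" "x i s" d] assms
  by (simp add: xb_def norm_minus_commute)

text \<open>Column sums equal to one remove the weights from the average.\<close>

lemma xb_step:
  assumes "regular_step s"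
  shows "xb (Suc s) = xb s + \<gamma> s *\<^sub>R avg (\<lambda>i. f i (x i s)) + avg (\<lambda>i. \<gamma> s *\<^sub>R \<epsilon> i (Suc s))"
proof -
  have "(\<Sum>i\<in>UNIV. \<Sum>j\<in>UNIV. W s $ i $ j *\<^sub>R x j s) = (\<Sum>j\<in>UNIV. x j s)"
    by (subst sum.swap) (simp add: scaleR_sum_left[symmetric] column_sum)
  then have "avg (\<lambda>i. \<Sum>j\<in>UNIV. W s $ i $ j *\<^sub>R x j s) = xb s"
    by (simp add: avg_def xb_def)
  then have "avg (\<lambda>i. x i (Suc s)) = xb s + avg (\<lambda>i. \<gamma> s *\<^sub>R (f i (x i s) + \<epsilon> i (Suc s)))"
    using assms by (simp add: regular_step_def avg_add)
  then show ?thesis by (simp add: xb_def avg_add avg_scaleR scaleR_add_right)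
qed

lemma xb_window:
  assumes "\<forall>r\<in>{n..<s}. regular_step r" "n \<le> s"
  shows "xb s - xb n = (\<Sum>r\<in>{n..<s}. \<gamma> r *\<^sub>R avg (\<lambda>i. f i (x i r))) +
    avg (\<lambda>i. \<Sum>r\<in>{n..<s}. \<gamma> r *\<^sub>R \<epsilon> i (Suc r))"
  using assms(2,1)
proof (induction s rule: dec_induct)
  case base
  then show ?case by (simp add: avg_def)
next
  case (step m)
  have "regular_step m" using step by auto
  from xb_step[OF this] step show ?case
    by (simp add: avg_add algebra_simps)
qed

text \<open>The noise condition concerns one choice of \<open>t T k\<close>, the conclusion all
  endpoints within time T at once; the worst endpoint is itself an admissible choice. As in the
  condition, T is fixed before k tends to infinity.\<close>

lemma noise_uniform:
  assumes n: "strict_mono n" and win: "\<And>k. tracked R (d k) (n k) (b k)"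
    and conv: "\<And>i. convergent (\<lambda>k. x i (n k))" and \<kappa>: "\<kappa> > 0"
  shows "\<forall>\<^sub>F T in at_right 0. \<forall>\<^sub>F k in sequentially. \<forall>s\<in>{n k..b k}. (\<Sum>r\<in>{n k..<s}. \<gamma> r) \<le> T \<longrightarrow>
    norm (avg (\<lambda>i. \<Sum>r\<in>{n k..<s}. \<gamma> r *\<^sub>R \<epsilon> i (Suc r))) \<le> \<kappa> * T"
proof -
  define g where "g = (\<lambda>i k s. \<Sum>r\<in>{n k..<s}. \<gamma> r *\<^sub>R \<epsilon> i (Suc r))"
  have "\<forall>\<^sub>F T in at_right 0. \<forall>\<^sub>F k in sequentially. \<forall>s\<in>{n k..b k}. (\<Sum>r\<in>{n k..<s}. \<gamma> r) \<le> T \<longrightarrow>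
    norm (g i k s) \<le> \<kappa> * T" for i
  proof -
    define A where "A = (\<lambda>T k. {s\<in>{n k..b k}. (\<Sum>r\<in>{n k..<s}. \<gamma> r) \<le> T})"
    have nb: "n k \<le> b k" for k using win by (auto simp: tracked_def)
    \<comment> \<open>A worst endpoint exists because the window is finite and its start
      \<open>n k\<close> always qualifies.\<close>
    have "\<exists>s. s \<in> A T k \<and> (\<forall>s'\<in>A T k. norm (g i k s') \<le> norm (g i k s))" if "T > 0" for T k
    proof -
      have A: "finite (A T k)" "n k \<in> A T k" using that nb by (auto simp: A_def)
      define X where "X = (\<lambda>s. norm (g i k s)) ` A T k"
      have X: "finite X" "X \<noteq> {}" using A by (auto simp: X_def)
      obtain s where "s \<in> A T k" "norm (g i k s) = Max X" using Max_in[OF X] by (auto simp: X_def)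
      moreover have "norm (g i k s') \<le> Max X" if "s' \<in> A T k" for s'
        by (rule Max_ge[OF X(1)]) (use that in \<open>auto simp: X_def\<close>)
      ultimately show ?thesis by (intro exI[of _ s]) auto
    qed
    then obtain S where S: "\<And>T k. T > 0 \<Longrightarrow> S T k \<in> A T k"
        "\<And>T k s. T > 0 \<Longrightarrow> s \<in> A T k \<Longrightarrow> norm (g i k s) \<le> norm (g i k (S T k))"
      by metis
    define t where "t = (\<lambda>T k. \<Sum>r\<in>{n k..<S T k}. \<gamma> r)"
    have t: "\<forall>T>0. \<forall>k. t T k \<in> {0..T}"
      using S(1) gamma_pos by (auto simp: t_def A_def less_imp_le intro!: sum_nonneg)
    have "\<forall>\<^sub>F K in at_top. \<forall>n. strict_mono n \<and> convergent (\<lambda>k. x i (n k)) \<longrightarrow>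
        (\<forall>t. (\<forall>T>0. \<forall>k. t T k \<in> {0..T}) \<longrightarrow>
           ((\<lambda>T. limsup (\<lambda>k. ereal (1 / T * norm
               (\<Sum>s | n k \<le> s \<and> int s \<le> horizon \<gamma> (n k) (t T k).
                  \<gamma> s *\<^sub>R of_bool (norm (x i s) \<le> K) *\<^sub>R \<epsilon> i (s + 1)))))
            \<longlongrightarrow> 0) (at_right (0::real)))"
      using noise by (auto simp: noise_cond_def)
    then have "\<forall>\<^sub>F K in at_top. K \<ge> R \<and> ((\<lambda>T. limsup (\<lambda>k. ereal (1 / T * norm
               (\<Sum>s | n k \<le> s \<and> int s \<le> horizon \<gamma> (n k) (t T k).
                  \<gamma> s *\<^sub>R of_bool (norm (x i s) \<le> K) *\<^sub>R \<epsilon> i (s + 1)))))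
            \<longlongrightarrow> 0) (at_right (0::real))"
      using eventually_ge_at_top[of R] by eventually_elim (use n conv t in blast)
    then obtain K where K: "K \<ge> R" "((\<lambda>T. limsup (\<lambda>k. ereal (1 / T * norm
               (\<Sum>s | n k \<le> s \<and> int s \<le> horizon \<gamma> (n k) (t T k).
                  \<gamma> s *\<^sub>R of_bool (norm (x i s) \<le> K) *\<^sub>R \<epsilon> i (s + 1)))))
            \<longlongrightarrow> 0) (at_right (0::real))"
      using eventually_happens'[OF trivial_limit_at_top_linorder] by blast
    have eq: "(\<Sum>s | n k \<le> s \<and> int s \<le> horizon \<gamma> (n k) (t T k).
          \<gamma> s *\<^sub>R of_bool (norm (x i s) \<le> K) *\<^sub>R \<epsilon> i (s + 1)) = g i k (S T k)" if "T > 0" for T k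
    proof -
      have "horizon \<gamma> (n k) (t T k) = int (S T k) - 1"
        unfolding t_def using S(1)[OF that, of k] gamma_pos by (intro horizon_sum) (auto simp: A_def)
      then have "{s. n k \<le> s \<and> int s \<le> horizon \<gamma> (n k) (t T k)} = {n k..<S T k}" by auto
      moreover have "norm (x i s) \<le> K" if "s \<in> {n k..<S T k}" for s
      proof -
        have "norm (x i s) \<le> R"
          using win[of k] S(1)[OF \<open>T > 0\<close>, of k] that by (auto simp: tracked_def A_def)
        then show ?thesis using K by simp
      qed
      ultimately show ?thesis by (auto simp: g_def intro!: sum.cong)
    qed
    have "\<forall>\<^sub>F T in at_right 0. limsup (\<lambda>k. ereal (1 / T * norm
               (\<Sum>s | n k \<le> s \<and> int s \<le> horizon \<gamma> (n k) (t T k).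
                  \<gamma> s *\<^sub>R of_bool (norm (x i s) \<le> K) *\<^sub>R \<epsilon> i (s + 1)))) < ereal \<kappa>"
      using K(2) \<kappa> by (intro order_tendstoD) auto
    then show ?thesis
      using eventually_at_right_less[of "0::real"]
    proof eventually_elim
      case (elim T)
      have "\<forall>\<^sub>F k in sequentially. ereal (1 / T * norm (g i k (S T k))) < ereal \<kappa>"
        using Limsup_lessD[OF elim(1)] by (simp only: eq[OF elim(2)])
      then show ?case
      proof eventually_elim
        case (elim k)
        have "norm (g i k (S T k)) \<le> \<kappa> * T" using elim \<open>0 < T\<close> by (simp add: field_simps)
        then show ?case using S(2)[OF \<open>0 < T\<close>, of _ k] by (fastforce simp: A_def)
      qed
    qed
  qed
  then have "\<forall>\<^sub>F T in at_right 0. \<forall>i. \<forall>\<^sub>F k in sequentially. \<forall>s\<in>{n k..b k}. (\<Sum>r\<in>{n k..<s}. \<gamma> r) \<le> T \<longrightarrow>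
    norm (g i k s) \<le> \<kappa> * T"
    by (rule eventually_all_finite)
  then show ?thesis
  proof eventually_elim
    case (elim T)
    then have "\<forall>\<^sub>F k in sequentially. \<forall>i. \<forall>s\<in>{n k..b k}. (\<Sum>r\<in>{n k..<s}. \<gamma> r) \<le> T \<longrightarrow> norm (g i k s) \<le> \<kappa> * T"
      by (intro eventually_all_finite) auto
    then show ?case
      by eventually_elim (auto simp: g_def intro!: norm_avg_le)
  qed
qed

text \<open>Limit points are extracted for the average, whereas the noise condition asks for
  convergence of the single agents.\<close>

lemma x_tendsto:
  assumes win: "\<And>k. tracked R (d k) (n k) (b k)" and d: "d \<longlonglongrightarrow> 0"
    and lim: "(\<lambda>k. xb (n k)) \<longlonglongrightarrow> z"
  shows "(\<lambda>k. x i (n k)) \<longlonglongrightarrow> z"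
proof -
  have "norm (x i (n k) - xb (n k)) \<le> d k" for k
    using win[of k] by (intro norm_x_minus_xb) (auto simp: tracked_def)
  then have "(\<lambda>k. x i (n k) - xb (n k)) \<longlonglongrightarrow> 0"
    by (intro Lim_null_comparison[OF _ d] always_eventually) auto
  from tendsto_add[OF this lim] show ?thesis by simp
qed

text \<open>On a tracked window the drift is at most F per unit of time, and the noise is at most T
  by \<open>noise_uniform\<close> with rate 1. So the path stays near z for short times without any
  prior assumption that it does.\<close>

lemma small_displacement:
  assumes n: "strict_mono n" and win: "\<And>k. tracked R (d k) (n k) (b k)" and d: "d \<longlonglongrightarrow> 0"
    and lim: "(\<lambda>k. xb (n k)) \<longlonglongrightarrow> z"
  obtains C where "C \<ge> 0" "\<forall>\<^sub>F T in at_right 0. \<forall>\<^sub>F k in sequentially. \<forall>s\<in>{n k..b k}.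
    (\<Sum>r\<in>{n k..<s}. \<gamma> r) \<le> T \<longrightarrow> norm (xb s - xb (n k)) \<le> C * T"
proof -
  obtain F where F: "F \<ge> 0" "\<And>i z. norm z \<le> R \<Longrightarrow> norm (f i z) \<le> F"
    using bounded_on_cball[of f R, OF f_cont] by blast
  have conv: "convergent (\<lambda>k. x i (n k))" for i
    using x_tendsto[OF win d lim] by (auto simp: convergent_def)
  show ?thesis
  proof
    show "F + 1 \<ge> 0" using F by simp
    show "\<forall>\<^sub>F T in at_right 0. \<forall>\<^sub>F k in sequentially. \<forall>s\<in>{n k..b k}.
      (\<Sum>r\<in>{n k..<s}. \<gamma> r) \<le> T \<longrightarrow> norm (xb s - xb (n k)) \<le> (F + 1) * T"
      using noise_uniform[OF n win conv zero_less_one]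
    proof eventually_elim
     case (elim T)
     then show ?case
     proof (eventually_elim, intro ballI impI)
      fix k s
      assume noise: "\<forall>s\<in>{n k..b k}. (\<Sum>r\<in>{n k..<s}. \<gamma> r) \<le> T \<longrightarrow>
          norm (avg (\<lambda>i. \<Sum>r\<in>{n k..<s}. \<gamma> r *\<^sub>R \<epsilon> i (Suc r))) \<le> 1 * T"
        and s: "s \<in> {n k..b k}" "(\<Sum>r\<in>{n k..<s}. \<gamma> r) \<le> T"
      have eq: "xb s - xb (n k) = (\<Sum>r\<in>{n k..<s}. \<gamma> r *\<^sub>R avg (\<lambda>i. f i (x i r))) +
        avg (\<lambda>i. \<Sum>r\<in>{n k..<s}. \<gamma> r *\<^sub>R \<epsilon> i (Suc r))"
        using win[of k] s by (intro xb_window) (auto simp: tracked_def)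
      have "norm (\<Sum>r\<in>{n k..<s}. \<gamma> r *\<^sub>R avg (\<lambda>i. f i (x i r))) \<le> (\<Sum>r\<in>{n k..<s}. \<gamma> r * F)"
      proof (rule sum_norm_le)
        fix r assume r: "r \<in> {n k..<s}"
        have "norm (avg (\<lambda>i. f i (x i r))) \<le> F"
          using win[of k] r s by (intro norm_avg_le F) (auto simp: tracked_def)
        then show "norm (\<gamma> r *\<^sub>R avg (\<lambda>i. f i (x i r))) \<le> \<gamma> r * F"
          using gamma_pos[of r] by (simp add: mult_left_mono)
      qed
      also have "\<dots> \<le> T * F" using s F by (simp add: sum_distrib_right[symmetric] mult_right_mono)
      finally show "norm (xb s - xb (n k)) \<le> (F + 1) * T"
        unfolding eq using bspec[OF noise s(1)] s(2) by (intro norm_triangle_le) (simp add: algebra_simps)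
     qed
    qed
  qed
qed

section \<open>Decrease of the Lyapunov function over short windows\<close>

lemma gradient_approximation:
  assumes \<kappa>: "\<kappa> \<ge> 0" and near: "\<And>w. w \<in> ball z \<rho> \<Longrightarrow> norm (vx w - vx z) \<le> \<kappa>"
    and ab: "a \<in> ball z \<rho>" "b \<in> ball z \<rho>"
  shows "\<bar>v b - v a - vx z \<bullet> (b - a)\<bar> \<le> \<kappa> * norm (b - a)"
proof -
  \<comment> \<open>Mean value estimate for v minus its linear part at z, whose gradient
    \<open>vx w - vx z\<close> is small on the ball.\<close>
  have "norm ((\<lambda>w. v w - vx z \<bullet> w) b - (\<lambda>w. v w - vx z \<bullet> w) a) \<le> \<kappa> * norm (b - a)"
  proof (rule differentiable_bound[where S = "ball z \<rho>" and f' = "\<lambda>w h. (vx w - vx z) \<bullet> h"])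
    fix w assume w: "w \<in> ball z \<rho>"
    have "(v has_derivative (\<lambda>h. vx w \<bullet> h)) (at w)"
      using gradient[of w] by (simp add: gderiv_def inner_commute)
    then have "((\<lambda>w. v w - vx z \<bullet> w) has_derivative (\<lambda>h. vx w \<bullet> h - vx z \<bullet> h)) (at w)"
      by (auto intro!: derivative_eq_intros)
    then show "((\<lambda>w. v w - vx z \<bullet> w) has_derivative (\<lambda>h. (vx w - vx z) \<bullet> h)) (at w within ball z \<rho>)"
      by (simp add: inner_diff_left has_derivative_at_withinI)
    show "onorm (\<lambda>h. (vx w - vx z) \<bullet> h) \<le> \<kappa>"
    proof (rule onorm_le)
      fix h
      have "norm ((vx w - vx z) \<bullet> h) \<le> norm (vx w - vx z) * norm h"
        by (simp add: Cauchy_Schwarz_ineq2)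
      also have "\<dots> \<le> \<kappa> * norm h" using near[OF w] by (intro mult_right_mono) auto
      finally show "norm ((vx w - vx z) \<bullet> h) \<le> \<kappa> * norm h" .
    qed
  qed (use ab in auto)
  then show ?thesis by (simp add: inner_diff_right algebra_simps)
qed

lemma descent:
  assumes n: "strict_mono n" and win: "\<And>k. tracked R (d k) (n k) (b k)" and d: "d \<longlonglongrightarrow> 0"
    and lim: "(\<lambda>k. xb (n k)) \<longlonglongrightarrow> z" and z: "z \<notin> root_set f"
  obtains c where "c > 0" "\<forall>\<^sub>F T in at_right 0. \<forall>\<^sub>F k in sequentially. \<forall>s\<in>{n k..b k}.
    T / 2 \<le> (\<Sum>r\<in>{n k..<s}. \<gamma> r) \<and> (\<Sum>r\<in>{n k..<s}. \<gamma> r) \<le> T \<longrightarrow> v (xb s) \<le> v (xb (n k)) - c * T"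
proof -
  define F where "F = avg (\<lambda>i. f i z)"
  \<comment> \<open>The rate of decrease at z is 4 c. A window of length at least T / 2 then gains 2
    c T, and half of this gain is reserved for the errors.\<close>
  define c where "c = - (F \<bullet> vx z) / 4"
  have c: "c > 0" "F \<bullet> vx z = - 4 * c" using decrease[OF z] by (auto simp: c_def F_def)
  \<comment> \<open>D collects the coefficients of the errors: \<open>2 * norm (vx z)\<close> from
    the deviation of the drift and the noise, each at most \<open>\<kappa> * T\<close>, and
    \<open>norm F + 2\<close> from the linearisation of v, where \<open>\<kappa>\<close> being at
    most 1 absorbs its square.\<close>
  define D where "D = 2 * norm (vx z) + norm F + 2"
  have D: "D > 0" by (auto simp: D_def intro: add_nonneg_pos)
  define \<kappa> where "\<kappa> = min 1 (c / D)"
  have \<kappa>: "\<kappa> > 0" "\<kappa> \<le> 1" "\<kappa> * D \<le> c" using c D by (auto simp: \<kappa>_def min_def field_simps)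
  have near: "\<forall>\<^sub>F w in nhds z. norm (vx w - vx z) \<le> \<kappa> \<and> (\<forall>i. norm (f i w - f i z) \<le> \<kappa>)"
  proof (intro eventually_conj eventually_all_finite)
    have *: "\<forall>\<^sub>F w in nhds z. norm (h w - h z) \<le> \<kappa>" if "continuous_on UNIV h" for h :: "real ^ 'l \<Rightarrow> real ^ 'l"
    proof -
      have "isCont h z" using that by (simp add: continuous_on_eq_continuous_at)
      then have "(h \<longlongrightarrow> h z) (nhds z)" by (simp add: continuous_at tendsto_nhds_iff)
      from tendstoD[OF this \<kappa>(1)] show ?thesis by eventually_elim (simp add: dist_norm)
    qed
    show "\<forall>\<^sub>F w in nhds z. norm (vx w - vx z) \<le> \<kappa>" using * vx_cont .
    show "\<forall>\<^sub>F w in nhds z. norm (f i w - f i z) \<le> \<kappa>" for i using * f_cont .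
  qed
  then obtain \<rho> where \<rho>: "\<rho> > 0" "\<And>w. w \<in> ball z \<rho> \<Longrightarrow> norm (vx w - vx z) \<le> \<kappa>"
      "\<And>w i. w \<in> ball z \<rho> \<Longrightarrow> norm (f i w - f i z) \<le> \<kappa>"
    unfolding eventually_nhds_metric by (metis mem_ball dist_commute)
  obtain C where C: "C \<ge> 0" "\<forall>\<^sub>F T in at_right 0. \<forall>\<^sub>F k in sequentially. \<forall>s\<in>{n k..b k}.
    (\<Sum>r\<in>{n k..<s}. \<gamma> r) \<le> T \<longrightarrow> norm (xb s - xb (n k)) \<le> C * T"
    by (rule small_displacement[OF n win d lim])
  have conv: "convergent (\<lambda>k. x i (n k))" for i
    using x_tendsto[OF win d lim] by (auto simp: convergent_def)
  \<comment> \<open>The radius is split in thirds, for the start, the displacement within time T and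
    the disagreement, so that every agent stays in the ball.\<close>
  have "((\<lambda>T. C * T) \<longlongrightarrow> C * 0) (at_right 0)" by (intro tendsto_intros)
  then have CT: "\<forall>\<^sub>F T in at_right 0. C * T < \<rho> / 3" using \<rho>(1) by (intro order_tendstoD) auto
  show ?thesis
  proof
    show "c > 0" by fact
    show "\<forall>\<^sub>F T in at_right 0. \<forall>\<^sub>F k in sequentially. \<forall>s\<in>{n k..b k}.
      T / 2 \<le> (\<Sum>r\<in>{n k..<s}. \<gamma> r) \<and> (\<Sum>r\<in>{n k..<s}. \<gamma> r) \<le> T \<longrightarrow> v (xb s) \<le> v (xb (n k)) - c * T"
      using C(2) noise_uniform[OF n win conv \<kappa>(1)] CT eventually_at_right_less[of "0::real"]
    proof eventually_elim
      case (elim T)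
      have "\<forall>\<^sub>F k in sequentially. dist (xb (n k)) z < \<rho> / 3" using tendstoD[OF lim, of "\<rho> / 3"] \<rho> by simp
      moreover have "\<forall>\<^sub>F k in sequentially. d k < \<rho> / 3" using order_tendstoD(2)[OF d, of "\<rho> / 3"] \<rho>(1) by simp
      ultimately show ?case
        using elim(1,2)
      proof (eventually_elim, intro ballI impI, elim conjE)
        fix k s
        assume zk: "dist (xb (n k)) z < \<rho> / 3" and dk: "d k < \<rho> / 3"
          and disp: "\<forall>s\<in>{n k..b k}. (\<Sum>r\<in>{n k..<s}. \<gamma> r) \<le> T \<longrightarrow> norm (xb s - xb (n k)) \<le> C * T"
          and noise: "\<forall>s\<in>{n k..b k}. (\<Sum>r\<in>{n k..<s}. \<gamma> r) \<le> T \<longrightarrow>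
            norm (avg (\<lambda>i. \<Sum>r\<in>{n k..<s}. \<gamma> r *\<^sub>R \<epsilon> i (Suc r))) \<le> \<kappa> * T"
          and s: "s \<in> {n k..b k}" "T / 2 \<le> (\<Sum>r\<in>{n k..<s}. \<gamma> r)" "(\<Sum>r\<in>{n k..<s}. \<gamma> r) \<le> T"
        have zk': "norm (xb (n k) - z) < \<rho> / 3" using zk by (simp add: dist_norm)
        have xbr: "norm (xb r - z) < 2 * (\<rho> / 3)" if r: "r \<in> {n k..s}" for r
        proof -
          have "(\<Sum>r\<in>{n k..<r}. \<gamma> r) \<le> (\<Sum>r\<in>{n k..<s}. \<gamma> r)"
            using r gamma_pos by (intro sum_mono2) (auto simp: less_imp_le)
          then have "norm (xb r - xb (n k)) \<le> C * T" using disp r s by auto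
          then show ?thesis
            using norm_triangle_ineq[of "xb r - xb (n k)" "xb (n k) - z"] zk' elim(3) by simp
        qed
        have xr: "x i r \<in> ball z \<rho>" if r: "r \<in> {n k..<s}" for r i
        proof -
          have "norm (x i r - xb r) \<le> d k"
            using win[of k] r s by (intro norm_x_minus_xb) (auto simp: tracked_def)
          then show ?thesis
            using norm_triangle_ineq[of "x i r - xb r" "xb r - z"] xbr[of r] r dk
            by (simp add: dist_norm norm_minus_commute)
        qed
        define S where "S = (\<Sum>r\<in>{n k..<s}. \<gamma> r)"
        define \<Delta> where "\<Delta> = xb s - xb (n k)"
        define e where "e = \<Delta> - S *\<^sub>R F"
        have S0: "S \<ge> 0" "S \<le> T" "T / 2 \<le> S" using s elim by (auto simp: S_def)
        have eq: "\<Delta> = (\<Sum>r\<in>{n k..<s}. \<gamma> r *\<^sub>R avg (\<lambda>i. f i (x i r))) +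
            avg (\<lambda>i. \<Sum>r\<in>{n k..<s}. \<gamma> r *\<^sub>R \<epsilon> i (Suc r))"
          using win[of k] s unfolding \<Delta>_def by (intro xb_window) (auto simp: tracked_def)
        have "norm (\<Sum>r\<in>{n k..<s}. \<gamma> r *\<^sub>R (avg (\<lambda>i. f i (x i r)) - F)) \<le> (\<Sum>r\<in>{n k..<s}. \<gamma> r * \<kappa>)"
        proof (rule sum_norm_le)
          fix r assume r: "r \<in> {n k..<s}"
          have "avg (\<lambda>i. f i (x i r)) - F = avg (\<lambda>i. f i (x i r) - f i z)"
            by (simp add: F_def avg_def sum_subtractf scaleR_diff_right)
          also have "norm \<dots> \<le> \<kappa>" by (intro norm_avg_le \<rho> xr r)
          finally show "norm (\<gamma> r *\<^sub>R (avg (\<lambda>i. f i (x i r)) - F)) \<le> \<gamma> r * \<kappa>"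
            using gamma_pos[of r] by (simp add: mult_left_mono)
        qed
        also have "\<dots> \<le> T * \<kappa>" using s \<kappa> by (simp add: sum_distrib_right[symmetric] mult_right_mono)
        finally have e1: "norm (\<Sum>r\<in>{n k..<s}. \<gamma> r *\<^sub>R (avg (\<lambda>i. f i (x i r)) - F)) \<le> T * \<kappa>" .
        have "e = (\<Sum>r\<in>{n k..<s}. \<gamma> r *\<^sub>R (avg (\<lambda>i. f i (x i r)) - F)) +
            avg (\<lambda>i. \<Sum>r\<in>{n k..<s}. \<gamma> r *\<^sub>R \<epsilon> i (Suc r))"
          by (simp add: e_def eq S_def scaleR_diff_right sum_subtractf scaleR_sum_left)
        then have e: "norm e \<le> 2 * \<kappa> * T"
          using e1 bspec[OF noise s(1)] s(3) by (auto intro!: norm_triangle_le simp: algebra_simps)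
        have \<Delta>: "norm \<Delta> \<le> norm F * T + 2 * \<kappa> * T"
        proof -
          have "norm (S *\<^sub>R F) \<le> norm F * T" using mult_right_mono[OF S0(2), of "norm F"] S0(1) by (simp add: mult.commute)
          then show ?thesis using e norm_triangle_ineq[of "S *\<^sub>R F" e] by (simp add: e_def)
        qed
        have "\<bar>v (xb s) - v (xb (n k)) - vx z \<bullet> \<Delta>\<bar> \<le> \<kappa> * norm \<Delta>"
          unfolding \<Delta>_def using \<kappa>(1) \<rho> xbr[of s] xbr[of "n k"] s
          by (intro gradient_approximation[of _ _ \<rho>]) (auto simp: dist_norm norm_minus_commute)
        also have "\<dots> \<le> \<kappa> * (norm F * T + 2 * \<kappa> * T)" using \<Delta> \<kappa> by (intro mult_left_mono) auto
        also have "\<dots> \<le> \<kappa> * (norm F * T + 2 * T)" using \<kappa> elim(4) by (intro mult_left_mono add_left_mono) auto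
        finally have v1: "v (xb s) - v (xb (n k)) \<le> vx z \<bullet> \<Delta> + \<kappa> * (norm F * T + 2 * T)" by linarith
        have "vx z \<bullet> \<Delta> = S * (F \<bullet> vx z) + vx z \<bullet> e"
          by (simp add: e_def inner_diff_right inner_commute)
        also have "S * (F \<bullet> vx z) \<le> - 2 * c * T"
          using mult_right_mono[OF S0(3), of "4 * c"] c by (simp add: mult.commute)
        also have "vx z \<bullet> e \<le> norm (vx z) * (2 * \<kappa> * T)"
          using norm_cauchy_schwarz[of "vx z" e] mult_left_mono[OF e norm_ge_zero[of "vx z"]] by linarith
        finally have v2: "vx z \<bullet> \<Delta> \<le> - 2 * c * T + norm (vx z) * (2 * \<kappa> * T)" by simp
        have "v (xb s) - v (xb (n k)) \<le> - 2 * c * T + (\<kappa> * D) * T"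
          using v1 v2 by (simp add: D_def algebra_simps)
        also have "(\<kappa> * D) * T \<le> c * T" using \<kappa>(3) elim(4) by (intro mult_right_mono) auto
        finally show "v (xb s) \<le> v (xb (n k)) - c * T" by (simp add: algebra_simps)
      qed
    qed
  qed
qed

text \<open>Makes the first point above a level share the limit of the last point not above
  it.\<close>

lemma increment_tendsto_0:
  assumes n: "strict_mono n" and win: "\<And>k. tracked R (d k) (n k) (b k)" and nb: "\<And>k. n k < b k"
  shows "(\<lambda>k. xb (Suc (n k)) - xb (n k)) \<longlonglongrightarrow> 0"
proof -
  obtain F where F: "F \<ge> 0" "\<And>i z. norm z \<le> R \<Longrightarrow> norm (f i z) \<le> F"
    using bounded_on_cball[of f R, OF f_cont] by blast
  have sub: "(\<lambda>k. g (n k)) \<longlonglongrightarrow> l" if "g \<longlonglongrightarrow> l" for g :: "nat \<Rightarrow> 'b::topological_space" and l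
    using LIMSEQ_subseq_LIMSEQ[OF that n] by (simp add: o_def)
  have "(\<lambda>k. avg (\<lambda>i. \<gamma> k *\<^sub>R \<epsilon> i (Suc k))) \<longlonglongrightarrow> (1 / real CARD('n)) *\<^sub>R (\<Sum>i\<in>(UNIV :: 'n set). 0)"
    unfolding avg_def by (intro tendsto_intros noise_vanishes)
  then have noise0: "(\<lambda>k. avg (\<lambda>i. \<gamma> k *\<^sub>R \<epsilon> i (Suc k))) \<longlonglongrightarrow> 0" by simp
  have "(\<lambda>k. \<gamma> (n k) * F + norm (avg (\<lambda>i. \<gamma> (n k) *\<^sub>R \<epsilon> i (Suc (n k))))) \<longlonglongrightarrow> 0 * F + norm (0 :: real ^ 'l)"
    by (intro tendsto_intros sub[OF gamma_0] sub[OF noise0])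
  then have bound0: "(\<lambda>k. \<gamma> (n k) * F + norm (avg (\<lambda>i. \<gamma> (n k) *\<^sub>R \<epsilon> i (Suc (n k))))) \<longlonglongrightarrow> 0"
    by simp
  have bound: "norm (xb (Suc (n k)) - xb (n k)) \<le>
      \<gamma> (n k) * F + norm (avg (\<lambda>i. \<gamma> (n k) *\<^sub>R \<epsilon> i (Suc (n k))))" for k
  proof -
    have "regular_step (n k)" using win[of k] nb[of k] by (auto simp: tracked_def)
    from xb_step[OF this] have eq: "xb (Suc (n k)) - xb (n k) =
      \<gamma> (n k) *\<^sub>R avg (\<lambda>i. f i (x i (n k))) + avg (\<lambda>i. \<gamma> (n k) *\<^sub>R \<epsilon> i (Suc (n k)))" by simp
    have "norm (avg (\<lambda>i. f i (x i (n k)))) \<le> F"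
      using win[of k] nb[of k] by (intro norm_avg_le F) (auto simp: tracked_def)
    then have "norm (\<gamma> (n k) *\<^sub>R avg (\<lambda>i. f i (x i (n k)))) \<le> \<gamma> (n k) * F"
      using gamma_pos[of "n k"] by (simp add: mult_left_mono)
    then show ?thesis unfolding eq by (intro norm_triangle_le) simp
  qed
  show ?thesis by (rule Lim_null_comparison[OF always_eventually[OF allI[OF bound]] bound0])
qed

text \<open>The starting points accumulate at some z. Their successors lie above
  \<open>\<delta>1\<close> and have the same limit, so v z equals \<open>\<delta>1\<close> and z is
  no root. Hence v decreases from there during a short time T; as the climb to
  \<open>\<delta>2\<close> takes longer than T, v would fall below \<open>\<delta>1\<close> within
  the crossing.\<close>

lemma no_upcrossing:
  assumes \<delta>: "\<delta>1 < \<delta>2" "\<delta>1 \<notin> v ` root_set f"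
    and crossing: "\<And>e N. e > 0 \<Longrightarrow> \<exists>n\<ge>N. \<exists>l>n. tracked R e n l \<and> v (xb n) \<le> \<delta>1 \<and>
      (\<forall>s\<in>{n<..l}. \<delta>1 < v (xb s)) \<and> \<delta>2 \<le> v (xb l)"
  shows False
proof -
  define Q where "Q = (\<lambda>e n l. n < l \<and> tracked R e n l \<and> v (xb n) \<le> \<delta>1 \<and>
      (\<forall>s\<in>{n<..l}. \<delta>1 < v (xb s)) \<and> \<delta>2 \<le> v (xb l))"
  have ex: "\<exists>n l. N \<le> n \<and> Q e n l" if "e > 0" for e N
    using crossing[OF that, of N] unfolding Q_def by blast
  \<comment> \<open>Crossings are chosen one after the other, with strictly increasing starts and
    disagreement at most 1 / (k + 1).\<close>
  have "\<exists>p. \<forall>k. (case p k of (n, l) \<Rightarrow> Q (1 / real (Suc k)) n l) \<and> fst (p k) < fst (p (Suc k))"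
  proof (rule dependent_nat_choice)
    show "\<exists>p. case p of (n, l) \<Rightarrow> Q (1 / real (Suc 0)) n l" using ex[of 1 0] by auto
    fix p :: "nat \<times> nat" and k
    obtain n l where "fst p < n" "Q (1 / real (Suc (Suc k))) n l"
      using ex[of "1 / real (Suc (Suc k))" "Suc (fst p)"] by (auto simp: Suc_le_eq)
    then show "\<exists>q. (case q of (n, l) \<Rightarrow> Q (1 / real (Suc (Suc k))) n l) \<and> fst p < fst q"
      by (intro exI[of _ "(n, l)"]) auto
  qed
  then obtain p where p: "\<And>k. Q (1 / real (Suc k)) (fst (p k)) (snd (p k))"
      "\<And>k. fst (p k) < fst (p (Suc k))" by (auto simp: case_prod_beta)
  have "bounded (range (\<lambda>k. xb (fst (p k))))"
  proof (rule boundedI)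
    fix y assume "y \<in> range (\<lambda>k. xb (fst (p k)))"
    then obtain k where "y = xb (fst (p k))" by auto
    then show "norm y \<le> R"
      using p(1)[of k] by (auto simp: Q_def tracked_def xb_def intro!: norm_avg_le)
  qed
  from bounded_imp_convergent_subsequence[OF this] obtain z r where
    r: "strict_mono r" and lim0: "((\<lambda>k. xb (fst (p k))) \<circ> r) \<longlonglongrightarrow> z" by blast
  define n l d where "n = (\<lambda>k. fst (p (r k)))" and "l = (\<lambda>k. snd (p (r k)))"
    and "d = (\<lambda>k. 1 / real (Suc (r k)))"
  have "strict_mono (\<lambda>k. fst (p k))" using p(2) by (simp add: strict_mono_Suc_iff)
  from strict_mono_o[OF this r] have n: "strict_mono n" by (simp add: n_def o_def)
  have lim: "(\<lambda>k. xb (n k)) \<longlonglongrightarrow> z" using lim0 by (simp add: n_def o_def)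
  have d0: "d \<longlonglongrightarrow> 0"
    using LIMSEQ_subseq_LIMSEQ[OF LIMSEQ_Suc[OF lim_inverse_n'] r]
    by (simp add: d_def o_def inverse_eq_divide)
  have Q: "n k < l k" "tracked R (d k) (n k) (l k)" "v (xb (n k)) \<le> \<delta>1"
    "\<And>s. n k < s \<Longrightarrow> s \<le> l k \<Longrightarrow> \<delta>1 < v (xb s)" "\<delta>2 \<le> v (xb (l k))" for k
    using p(1)[of "r k"] by (auto simp: Q_def n_def l_def d_def)
  have vlim: "(\<lambda>k. v (g k)) \<longlonglongrightarrow> v z" if "g \<longlonglongrightarrow> z" for g
    using v_cont that by (intro continuous_on_tendsto_compose[OF v_cont]) auto
  have "(\<lambda>k. xb (Suc (n k)) - xb (n k) + xb (n k)) \<longlonglongrightarrow> 0 + z"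
    by (intro tendsto_add increment_tendsto_0[OF n Q(2,1)] lim)
  then have "(\<lambda>k. xb (Suc (n k))) \<longlonglongrightarrow> z" by simp
  moreover have "\<delta>1 \<le> v (xb (Suc (n k)))" for k
    using Q(1)[of k] Q(4)[of k "Suc (n k)"] by simp
  ultimately have "\<delta>1 \<le> v z" by (intro LIMSEQ_le_const[OF vlim]) auto
  moreover have "v z \<le> \<delta>1"
    by (rule LIMSEQ_le_const2[OF vlim[OF lim]]) (use Q(3) in auto)
  ultimately have vz: "v z = \<delta>1" by simp
  then have z: "z \<notin> root_set f" using \<delta> by auto
  obtain c where c: "c > 0" "\<forall>\<^sub>F T in at_right 0. \<forall>\<^sub>F k in sequentially. \<forall>s\<in>{n k..l k}.
      T / 2 \<le> (\<Sum>r\<in>{n k..<s}. \<gamma> r) \<and> (\<Sum>r\<in>{n k..<s}. \<gamma> r) \<le> T \<longrightarrow> v (xb s) \<le> v (xb (n k)) - c * T"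
    using descent[OF n Q(2) d0 lim z] by blast
  obtain C where C: "C \<ge> 0" "\<forall>\<^sub>F T in at_right 0. \<forall>\<^sub>F k in sequentially. \<forall>s\<in>{n k..l k}.
    (\<Sum>r\<in>{n k..<s}. \<gamma> r) \<le> T \<longrightarrow> norm (xb s - xb (n k)) \<le> C * T"
    using small_displacement[OF n Q(2) d0 lim] by blast
  have "\<forall>\<^sub>F w in nhds z. v w < \<delta>2"
  proof (rule order_tendstoD)
    show "(v \<longlongrightarrow> v z) (nhds z)"
      using v_cont by (simp add: continuous_on_eq_continuous_at continuous_at tendsto_nhds_iff)
  qed (use vz \<delta> in simp)
  then obtain \<rho> where \<rho>: "\<rho> > 0" "\<And>w. dist w z < \<rho> \<Longrightarrow> v w < \<delta>2"
    unfolding eventually_nhds_metric by auto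
  have "((\<lambda>T. C * T) \<longlongrightarrow> C * 0) (at_right 0)" by (intro tendsto_intros)
  then have "\<forall>\<^sub>F T in at_right 0. C * T < \<rho> / 2" using \<rho>(1) by (intro order_tendstoD) auto
  from eventually_happens'[OF _ eventually_conj[OF eventually_conj[OF this eventually_at_right_less[of "0::real"]]
      eventually_conj[OF c(2) C(2)]]]
  obtain T where T: "C * T < \<rho> / 2" "T > 0"
    "\<forall>\<^sub>F k in sequentially. \<forall>s\<in>{n k..l k}.
      T / 2 \<le> (\<Sum>r\<in>{n k..<s}. \<gamma> r) \<and> (\<Sum>r\<in>{n k..<s}. \<gamma> r) \<le> T \<longrightarrow> v (xb s) \<le> v (xb (n k)) - c * T"
    "\<forall>\<^sub>F k in sequentially. \<forall>s\<in>{n k..l k}.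
      (\<Sum>r\<in>{n k..<s}. \<gamma> r) \<le> T \<longrightarrow> norm (xb s - xb (n k)) \<le> C * T"
    by (auto simp: trivial_limit_at_right_real)
  obtain K where K: "\<And>r. r \<ge> K \<Longrightarrow> \<gamma> r < T / 2"
    using order_tendstoD(2)[OF gamma_0, of "T / 2"] T(2) by (auto simp: eventually_sequentially)
  have "\<forall>\<^sub>F k in sequentially. dist (xb (n k)) z < \<rho> / 2" using tendstoD[OF lim, of "\<rho> / 2"] \<rho>(1) by simp
  from eventually_happens'[OF _ eventually_conj[OF eventually_conj[OF this eventually_ge_at_top[of K]]
      eventually_conj[OF T(3,4)]]]
  obtain k where k: "dist (xb (n k)) z < \<rho> / 2" "k \<ge> K"
    "\<forall>s\<in>{n k..l k}. T / 2 \<le> (\<Sum>r\<in>{n k..<s}. \<gamma> r) \<and> (\<Sum>r\<in>{n k..<s}. \<gamma> r) \<le> T \<longrightarrow>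
      v (xb s) \<le> v (xb (n k)) - c * T"
    "\<forall>s\<in>{n k..l k}. (\<Sum>r\<in>{n k..<s}. \<gamma> r) \<le> T \<longrightarrow> norm (xb s - xb (n k)) \<le> C * T"
    by auto
  have nk: "n k \<ge> K" using seq_suble[OF n, of k] k(2) by simp
  \<comment> \<open>Within time T the average moves by less than half of \<open>\<rho>\<close>, too
    little to reach the value \<open>\<delta>2\<close>; so the window is long enough for the
    descent.\<close>
  have "(\<Sum>r\<in>{n k..<l k}. \<gamma> r) > T"
  proof (rule ccontr)
    assume "\<not> ?thesis"
    then have "norm (xb (l k) - xb (n k)) \<le> C * T" using k(4) Q(1)[of k] by auto
    then have "dist (xb (l k)) z < \<rho>"
      using T(1) k(1) dist_triangle[of "xb (l k)" z "xb (n k)"] by (simp add: dist_norm)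
    then show False using \<rho>(2) Q(5)[of k] by fastforce
  qed
  then obtain s where s: "n k < s" "s < l k" "T / 2 \<le> (\<Sum>r\<in>{n k..<s}. \<gamma> r)" "(\<Sum>r\<in>{n k..<s}. \<gamma> r) \<le> T"
    using half_step_exists[of "n k" "l k" T \<gamma>] Q(1)[of k] T(2) K nk by fastforce
  then have "v (xb s) \<le> v (xb (n k)) - c * T" using k(3) by auto
  moreover have "c * T > 0" using c(1) T(2) by simp
  ultimately show False using Q(3)[of k] Q(4)[of k s] s by simp
qed

lemma gamma_sum_unbounded: "\<exists>b>n. (\<Sum>r\<in>{n..<b}. \<gamma> r) > T"
proof -
  have "\<forall>\<^sub>F m in sequentially. T + (\<Sum>r\<in>{..<n}. \<gamma> r) < (\<Sum>k=1..m. \<gamma> k)"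
    using gamma_sum by (simp add: filterlim_at_top_dense)
  from eventually_happens'[OF _ eventually_conj[OF this eventually_ge_at_top[of n]]]
  obtain m where m: "T + (\<Sum>r\<in>{..<n}. \<gamma> r) < (\<Sum>k=1..m. \<gamma> k)" "n \<le> m" by auto
  \<comment> \<open>The divergent sum starts at 1; the positive term of index 0 only enlarges the
    right-hand side.\<close>
  have "(\<Sum>k=1..m. \<gamma> k) \<le> (\<Sum>k\<in>{..<n} \<union> {n..<Suc m}. \<gamma> k)"
    using gamma_pos by (intro sum_mono2) (auto simp: less_imp_le)
  also have "\<dots> = (\<Sum>r\<in>{..<n}. \<gamma> r) + (\<Sum>r\<in>{n..<Suc m}. \<gamma> r)"
    by (rule sum.union_disjoint) auto
  finally show ?thesis using m by (intro exI[of _ "Suc m"]) simp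
qed

lemma limit_point_is_root:
  assumes reg: "\<And>k. k \<ge> k0 \<Longrightarrow> regular_step k"
    and bdd: "\<And>i k. k \<ge> k0 \<Longrightarrow> norm (x i k) \<le> R"
    and spread: "\<And>e. e > 0 \<Longrightarrow> \<forall>\<^sub>F k in sequentially. \<forall>i j. norm (x i k - x j k) \<le> e"
    and vlim: "(\<lambda>k. v (xb k)) \<longlonglongrightarrow> V"
    and m: "strict_mono m" "(\<lambda>k. xb (m k)) \<longlonglongrightarrow> z"
  shows "z \<in> root_set f"
proof (rule ccontr)
  assume z: "z \<notin> root_set f"
  have "\<forall>q. \<exists>N. \<forall>k\<ge>N. \<forall>i j. norm (x i k - x j k) \<le> 1 / real (Suc q)"
    using spread by (simp add: eventually_sequentially)
  then obtain N where N: "\<And>q k i j. k \<ge> N q \<Longrightarrow> norm (x i k - x j k) \<le> 1 / real (Suc q)" by metis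
  \<comment> \<open>Summing the thresholds gives a strictly increasing sequence that dominates each
    of them, so from \<open>n q\<close> on the disagreement is at most 1 / (q + 1).\<close>
  define r where "r = (\<lambda>q. \<Sum>j\<le>q. N j + k0 + 1)"
  have r: "strict_mono r" by (simp add: strict_mono_Suc_iff r_def)
  have rN: "r q \<ge> N q + k0" for q
    using member_le_sum[of q "{..q}" "\<lambda>j. N j + k0 + 1"] by (simp add: r_def)
  define n where "n = (\<lambda>q. m (r q))"
  have n: "strict_mono n" using strict_mono_o[OF m(1) r] by (simp add: n_def o_def)
  have nN: "n q \<ge> N q + k0" for q
    using seq_suble[OF m(1), of "r q"] rN[of q] unfolding n_def by linarith
  have lim: "(\<lambda>q. xb (n q)) \<longlonglongrightarrow> z"
    using LIMSEQ_subseq_LIMSEQ[OF m(2) r] by (simp add: n_def o_def)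
  \<comment> \<open>No crossing delimits the window here. It is made longer than 1 in elapsed time,
    so that every T below 1 fits.\<close>
  have "\<forall>q. \<exists>b>n q. (\<Sum>r\<in>{n q..<b}. \<gamma> r) > 1" using gamma_sum_unbounded by blast
  then obtain b where b: "\<And>q. b q > n q" "\<And>q. (\<Sum>r\<in>{n q..<b q}. \<gamma> r) > 1" by metis
  define d where "d = (\<lambda>q. 1 / real (Suc q))"
  have d0: "d \<longlonglongrightarrow> 0" unfolding d_def using LIMSEQ_Suc[OF lim_inverse_n'] by simp
  have win: "tracked R (d q) (n q) (b q)" for q
    using b(1)[of q] nN[of q] reg bdd N[of q] by (auto simp: tracked_def d_def less_imp_le)
  obtain c where c: "c > 0" "\<forall>\<^sub>F T in at_right 0. \<forall>\<^sub>F k in sequentially. \<forall>s\<in>{n k..b k}.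
      T / 2 \<le> (\<Sum>r\<in>{n k..<s}. \<gamma> r) \<and> (\<Sum>r\<in>{n k..<s}. \<gamma> r) \<le> T \<longrightarrow> v (xb s) \<le> v (xb (n k)) - c * T"
    using descent[OF n win d0 lim z] by blast
  have "\<forall>\<^sub>F T in at_right 0. T < (1::real)" by (rule order_tendstoD(2)[OF tendsto_ident_at]) simp
  from eventually_happens'[OF _ eventually_conj[OF eventually_conj[OF this eventually_at_right_less[of "0::real"]] c(2)]]
  obtain T where T: "T < 1" "T > 0"
    "\<forall>\<^sub>F k in sequentially. \<forall>s\<in>{n k..b k}.
      T / 2 \<le> (\<Sum>r\<in>{n k..<s}. \<gamma> r) \<and> (\<Sum>r\<in>{n k..<s}. \<gamma> r) \<le> T \<longrightarrow> v (xb s) \<le> v (xb (n k)) - c * T"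
    by (auto simp: trivial_limit_at_right_real)
  obtain K where K: "\<And>r. r \<ge> K \<Longrightarrow> \<gamma> r < T / 2"
    using order_tendstoD(2)[OF gamma_0, of "T / 2"] T(2) by (auto simp: eventually_sequentially)
  have cT: "c * T / 2 > 0" using c T by simp
  obtain K' where K': "\<And>k. k \<ge> K' \<Longrightarrow> \<bar>v (xb k) - V\<bar> < c * T / 2"
    using tendstoD[OF vlim cT] by (auto simp: eventually_sequentially dist_real_def)
  from eventually_happens'[OF _ eventually_conj[OF eventually_ge_at_top[of "K + K'"] T(3)]]
  obtain q where q: "q \<ge> K + K'" "\<forall>s\<in>{n q..b q}.
      T / 2 \<le> (\<Sum>r\<in>{n q..<s}. \<gamma> r) \<and> (\<Sum>r\<in>{n q..<s}. \<gamma> r) \<le> T \<longrightarrow> v (xb s) \<le> v (xb (n q)) - c * T"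
    by auto
  have nq: "n q \<ge> K" "n q \<ge> K'" using seq_suble[OF n, of q] q(1) by auto
  obtain s where s: "n q < s" "s < b q" "T / 2 \<le> (\<Sum>r\<in>{n q..<s}. \<gamma> r)" "(\<Sum>r\<in>{n q..<s}. \<gamma> r) \<le> T"
    using half_step_exists[of "n q" "b q" T \<gamma>] b[of q] T K nq by fastforce
  then have "v (xb s) \<le> v (xb (n q)) - c * T" using q by auto
  then show False using K'[of s] K'[of "n q"] nq s by (simp add: abs_if split: if_splits)
qed

end

section \<open>Finiteness of truncations\<close>

text \<open>\<open>\<mu>\<close> is a lower bound of v on the sphere of radius
  \<open>c\<^sub>0\<close> that exceeds \<open>v xstar\<close>; in the end it is the infimum
  itself.\<close>

locale dsaawet_path = approximation_path E W \<eta> B f \<gamma> x \<epsilon> v vx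
  for E :: "nat \<Rightarrow> ('n::finite \<times> 'n) set" and W \<eta> B
    and f :: "'n \<Rightarrow> real ^ 'l::finite \<Rightarrow> real ^ 'l" and \<gamma> x \<epsilon> v vx +
  fixes M :: "nat \<Rightarrow> real" and xstar :: "real ^ 'l" and Obs :: "'n \<Rightarrow> nat \<Rightarrow> real ^ 'l"
    and \<sigma> :: "'n \<Rightarrow> nat \<Rightarrow> nat" and c\<^sub>0 \<mu> :: real
  assumes algorithm: "dsaawet E W \<gamma> xstar M Obs x \<sigma>"
    and observation: "Obs i (Suc k) = f i (x i k) + \<epsilon> i (Suc k)"
    and M_mono: "incseq M" and M_lim: "filterlim M at_top sequentially" and M_0: "norm xstar \<le> M 0"
    and xstar_less: "norm xstar < c\<^sub>0" and v_xstar: "v xstar < \<mu>"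
    and v_sphere: "\<And>z. norm z = c\<^sub>0 \<Longrightarrow> \<mu> \<le> v z"
    and nowhere_dense: "interior (closure (v ` root_set f)) = {}"
begin

section \<open>Truncation levels, leading agents and resets\<close>

definition level where "level k = Max (range (\<lambda>i. \<sigma> i k))"

abbreviation sh where "sh i k \<equiv> sigma_hat (E k) (\<lambda>j. \<sigma> j k) i"

definition xp where
  "xp i k = of_bool (\<sigma> i k = sh i k) *\<^sub>R
      ((\<Sum>j\<in>nbrs (E k) i. W k $ i $ j *\<^sub>R
          (of_bool (\<sigma> j k = sh i k) *\<^sub>R x j k + of_bool (\<sigma> j k < sh i k) *\<^sub>R xstar))
       + \<gamma> k *\<^sub>R Obs i (k + 1))
    + of_bool (\<sigma> i k < sh i k) *\<^sub>R xstar"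

lemma x_Suc: "x i (Suc k) = (if norm (xp i k) > M (sh i k) then xstar else xp i k)"
  and sigma_Suc: "\<sigma> i (Suc k) = sh i k + of_bool (norm (xp i k) > M (sh i k))"
proof -
  have "x i (k + 1) = of_bool (norm (xp i k) > M (sh i k)) *\<^sub>R xstar +
      of_bool (norm (xp i k) \<le> M (sh i k)) *\<^sub>R xp i k \<and>
      \<sigma> i (k + 1) = sh i k + of_bool (norm (xp i k) > M (sh i k))"
    using algorithm unfolding dsaawet_def Let_def xp_def by blast
  then show "x i (Suc k) = (if norm (xp i k) > M (sh i k) then xstar else xp i k)"
    "\<sigma> i (Suc k) = sh i k + of_bool (norm (xp i k) > M (sh i k))" by auto
qed

lemma sigma_le_level: "\<sigma> i k \<le> level k"
  unfolding level_def by (rule Max_ge) auto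

lemma level_attained: "\<exists>i. \<sigma> i k = level k"
proof -
  have "level k \<in> range (\<lambda>i. \<sigma> i k)" unfolding level_def by (rule Max_in) auto
  then show ?thesis by auto
qed

lemma sigma_le_sh: "j \<in> nbrs (E k) i \<Longrightarrow> \<sigma> j k \<le> sh i k"
  unfolding sigma_hat_def by (rule Max_ge) auto

lemma sh_le_level: "sh i k \<le> level k"
  unfolding sigma_hat_def using self_loop[of i k] sigma_le_level by (subst Max_le_iff) auto

lemma sh_eq_level: "j \<in> nbrs (E k) i \<Longrightarrow> \<sigma> j k = level k \<Longrightarrow> sh i k = level k"
  using sigma_le_sh[of j k i] sh_le_level[of k i] by simp

lemma level_Suc: "level k \<le> level (Suc k)" "level (Suc k) \<le> level k + 1"
proof -
  obtain i where i: "\<sigma> i k = level k" using level_attained by blast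
  then show "level k \<le> level (Suc k)"
    using sh_eq_level[OF self_loop i] sigma_Suc[of i k] sigma_le_level[of i "Suc k"] by simp
  obtain j where "\<sigma> j (Suc k) = level (Suc k)" using level_attained by blast
  then show "level (Suc k) \<le> level k + 1"
    using sigma_Suc[of j k] sh_le_level[of k j] by (auto split: split_of_bool_asm)
qed

lemma level_mono: "k \<le> k' \<Longrightarrow> level k \<le> level k'"
  using lift_Suc_mono_le[of level] level_Suc(1) by blast

definition y where "y i k = (if \<sigma> i k = level k then x i k else xstar)"

definition yb where "yb k = avg (\<lambda>i. y i k)"

abbreviation step_of where
  "step_of i k \<equiv> (\<Sum>j\<in>UNIV. W k $ i $ j *\<^sub>R y j k) + \<gamma> k *\<^sub>R (f i (y i k) + \<epsilon> i (Suc k))"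

lemma M_ge: "norm xstar \<le> M m"
  using M_0 incseqD[OF M_mono, of 0 m] by simp

text \<open>A leading agent replaces neighbours of lower level by \<open>xstar\<close>, which is
  what \<open>y\<close> does for all agents at once. So the leading agents follow the plain
  recursion in \<open>y\<close>.\<close>

lemma xp_leading:
  assumes "\<sigma> i k = level k"
  shows "xp i k = step_of i k"
proof -
  have sh: "sh i k = level k" using sh_eq_level[OF self_loop assms] .
  have "of_bool (\<sigma> j k = level k) *\<^sub>R x j k + of_bool (\<sigma> j k < level k) *\<^sub>R xstar = y j k" for j
    using sigma_le_level[of j k] by (auto simp: y_def)
  then show ?thesis
    unfolding xp_def sh using assms observation by (simp add: sum_nbrs) (simp add: y_def)
qed

lemma xp_lagging: "\<sigma> i k < sh i k \<Longrightarrow> xp i k = xstar"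
  by (simp add: xp_def)

text \<open>An agent reaches the new level only by truncation, which puts it at
  \<open>xstar\<close>; all others now lag and count as being at \<open>xstar\<close>. So the
  modified states restart together.\<close>

lemma reset:
  assumes "level (Suc k) \<noteq> level k"
  shows "y i (Suc k) = xstar"
  using assms level_Suc[of k] sh_le_level[of k i] x_Suc[of i k] sigma_Suc[of i k]
  by (auto simp: y_def split: if_splits)

text \<open>An agent behind one of its neighbours proposes \<open>xstar\<close>, whose norm never
  exceeds the bound; the overflow is therefore due to a leading agent.\<close>

lemma reset_cause:
  assumes "level (Suc k) \<noteq> level k"
  shows "\<exists>i. norm (step_of i k) > M (level k)"
proof -
  have level: "level (Suc k) = level k + 1" using assms level_Suc[of k] by simp
  obtain i where i: "\<sigma> i (Suc k) = level (Suc k)" using level_attained by blast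
  then have sh: "sh i k = level k" and trunc: "norm (xp i k) > M (sh i k)"
    using level sigma_Suc[of i k] sh_le_level[of k i] by (auto split: split_of_bool_asm)
  have "\<sigma> i k = level k"
  proof (rule ccontr)
    assume "\<not> ?thesis"
    then have "xp i k = xstar" using sigma_le_level[of i k] sh by (intro xp_lagging) simp
    then show False using trunc M_ge[of "sh i k"] by simp
  qed
  from xp_leading[OF this] show ?thesis using trunc sh by metis
qed

lemma leading_step:
  assumes "level (Suc k) = level k" "\<sigma> i k = level k"
  shows "y i (Suc k) = step_of i k" "\<sigma> i (Suc k) = level (Suc k)" "norm (y i (Suc k)) \<le> M (level k)"
proof -
  have sh: "sh i k = level k" using sh_eq_level[OF self_loop assms(2)] .
  have nt: "\<not> norm (xp i k) > M (sh i k)"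
    using sigma_le_level[of i "Suc k"] sigma_Suc[of i k] assms sh by auto
  then show s: "\<sigma> i (Suc k) = level (Suc k)" using sigma_Suc[of i k] sh assms by simp
  have yx: "y i (Suc k) = xp i k" using s nt x_Suc[of i k] by (simp add: y_def)
  then show "y i (Suc k) = step_of i k" using xp_leading[OF assms(2)] by simp
  show "norm (y i (Suc k)) \<le> M (level k)" using yx nt sh by simp
qed

text \<open>An agent can catch up with the maximum through a leading neighbour or by a truncation
  one level below. Both put it at \<open>xstar\<close>, so its modified state does not move.\<close>

lemma lagging_step:
  assumes "level (Suc k) = level k" "\<sigma> i k \<noteq> level k"
  shows "y i (Suc k) = xstar" "y i k = xstar"
proof -
  show "y i k = xstar" using assms by (simp add: y_def)
  have lt: "\<sigma> i k < level k" using assms sigma_le_level[of i k] by simp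
  show "y i (Suc k) = xstar"
  proof (cases "sh i k = level k")
    case True
    then have "xp i k = xstar" using lt by (intro xp_lagging) simp
    then show ?thesis using x_Suc[of i k] by (simp add: y_def)
  next
    case False
    then show ?thesis
      using assms sh_le_level[of k i] x_Suc[of i k] sigma_Suc[of i k]
      by (auto simp: y_def split: if_splits)
  qed
qed

lemma leading_spreads:
  assumes "level (Suc k) = level k" "\<sigma> j k = level k" "(j, i) \<in> E k"
  shows "\<sigma> i (Suc k) = level (Suc k)"
proof -
  have "sh i k = level k" using sh_eq_level[of j k i] assms by (simp add: nbrs_def)
  then show ?thesis using sigma_Suc[of i k] sigma_le_level[of i "Suc k"] assms by (auto split: if_splits)
qed

text \<open>Leading travels along edges, so without resets it reaches all agents within L steps, and
  it persists afterwards.\<close>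

lemma all_leading:
  assumes "\<And>k. n \<le> k \<Longrightarrow> k < n + L + t \<Longrightarrow> level (Suc k) = level k"
  shows "\<sigma> i (n + L + t) = level (n + L + t)"
  using assms
proof (induction t arbitrary: i)
  case 0
  have "{i. \<sigma> i (n + L) = level (n + L)} = UNIV"
  proof (rule spread_everywhere[of "\<lambda>k. {i. \<sigma> i k = level k}"])
    show "{i. \<sigma> i n = level n} \<noteq> {}" using level_attained[of n] by auto
  qed (use 0 leading_spreads in auto)
  then show ?case by auto
next
  case (Suc t)
  have "\<sigma> i (n + L + t) = level (n + L + t)" by (rule Suc.IH) (use Suc.prems in auto)
  with leading_step(2)[of "n + L + t" i] Suc.prems[of "n + L + t"] show ?case by simp
qed

lemma regular_step_if_all_leading:
  assumes "level (Suc k) = level k" "\<And>i. \<sigma> i k = level k"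
  shows "regular_step k"
  unfolding regular_step_def
proof
  fix i
  have "x i (Suc k) = y i (Suc k)" using leading_step(2)[OF assms] by (simp add: y_def)
  also have "\<dots> = step_of i k" using leading_step(1)[OF assms] .
  also have "\<dots> = (\<Sum>j\<in>UNIV. W k $ i $ j *\<^sub>R x j k) + \<gamma> k *\<^sub>R (f i (x i k) + \<epsilon> i (Suc k))"
    using assms(2) by (simp add: y_def)
  finally show "x i (Suc k) = (\<Sum>j\<in>UNIV. W k $ i $ j *\<^sub>R x j k) + \<gamma> k *\<^sub>R (f i (x i k) + \<epsilon> i (Suc k))" .
qed

text \<open>Lagging agents stand still at \<open>xstar\<close>, so in both cases the new state is an average of old
  states up to the perturbation bound \<open>\<beta>\<close>.\<close>

lemma approx_average:
  assumes "level (Suc k) = level k" "\<And>i. norm (\<gamma> k *\<^sub>R (f i (y i k) + \<epsilon> i (Suc k))) \<le> \<beta>" "\<beta> \<ge> 0"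
  obtains a where "\<And>j. a j \<ge> 0" "(\<Sum>j\<in>UNIV. a j) = 1"
    "norm (y i (Suc k) - (\<Sum>j\<in>UNIV. a j *\<^sub>R y j k)) \<le> \<beta>"
proof (cases "\<sigma> i k = level k")
  case True
  show ?thesis
    by (rule that[of "\<lambda>j. W k $ i $ j"])
       (use weight_nonneg row_sum assms(2)[of i] leading_step(1)[OF assms(1) True] in auto)
next
  case False
  have "(\<Sum>j\<in>UNIV. of_bool (j = i) *\<^sub>R y j k) = (\<Sum>j\<in>UNIV. if j = i then y j k else 0)"
    by (rule sum.cong) auto
  then show ?thesis
    using lagging_step[OF assms(1) False] assms(3)
    by (intro that[of "\<lambda>j. of_bool (j = i)"]) auto
qed

text \<open>Write D for the bound, so that \<open>\<eta> ^ L * D\<close> is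
  \<open>4 * real L * \<beta>\<close>. A contracting block of L steps loses this amount and gains at
  most \<open>2 * real L * \<beta>\<close>, hence stays below D. The factor 4 covers the first 2 L
  steps, in which the spread grows by at most \<open>2 * \<beta>\<close> each.\<close>

lemma episode_spread:
  assumes const: "\<And>k. \<tau> \<le> k \<Longrightarrow> k < s \<Longrightarrow> level (Suc k) = level k"
    and start: "\<And>i. y i \<tau> = xstar"
    and pert: "\<And>k i. \<tau> \<le> k \<Longrightarrow> k < s \<Longrightarrow> norm (\<gamma> k *\<^sub>R (f i (y i k) + \<epsilon> i (Suc k))) \<le> \<beta>"
    and s: "\<tau> \<le> s" and \<beta>: "\<beta> \<ge> 0"
  shows "norm (y i s - y j s) \<le> 4 * real L / \<eta> ^ L * \<beta>"
  using s const pert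
proof (induction s arbitrary: i j rule: less_induct)
  case (less s)
  have \<alpha>: "0 < \<eta> ^ L" "\<eta> ^ L \<le> 1" using eta by (auto intro: power_le_one)
  have short: "norm (y i (\<tau> + t) - y j (\<tau> + t)) \<le> 2 * real t * \<beta>" if "\<tau> + t \<le> s" for t i j
    using that
  proof (induction t arbitrary: i j)
    case 0
    then show ?case using start by simp
  next
    case (Suc t)
    have c: "level (Suc (\<tau> + t)) = level (\<tau> + t)"
      "\<And>i. norm (\<gamma> (\<tau> + t) *\<^sub>R (f i (y i (\<tau> + t)) + \<epsilon> i (Suc (\<tau> + t)))) \<le> \<beta>"
      using less.prems Suc.prems by auto
    obtain a where a: "\<And>j. a j \<ge> 0" "(\<Sum>j\<in>UNIV. a j) = 1"
      "norm (y i (Suc (\<tau> + t)) - (\<Sum>j\<in>UNIV. a j *\<^sub>R y j (\<tau> + t))) \<le> \<beta>"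
      using approx_average[OF c \<beta>, of i] by blast
    obtain b where b: "\<And>j. b j \<ge> 0" "(\<Sum>j\<in>UNIV. b j) = 1"
      "norm (y j (Suc (\<tau> + t)) - (\<Sum>j\<in>UNIV. b j *\<^sub>R y j (\<tau> + t))) \<le> \<beta>"
      using approx_average[OF c \<beta>, of j] by blast
    have "norm ((\<Sum>j\<in>UNIV. a j *\<^sub>R y j (\<tau> + t)) - (\<Sum>j\<in>UNIV. b j *\<^sub>R y j (\<tau> + t))) \<le> 1 * (2 * real t * \<beta>)"
      using Suc by (intro norm_diff_weighted_sums_le a b) auto
    moreover have "norm ((y i (Suc (\<tau> + t)) - (\<Sum>j\<in>UNIV. a j *\<^sub>R y j (\<tau> + t))) -
        (y j (Suc (\<tau> + t)) - (\<Sum>j\<in>UNIV. b j *\<^sub>R y j (\<tau> + t)))) \<le> \<beta> + \<beta>"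
      using a(3) b(3) by (intro norm_triangle_le_diff) simp
    ultimately have "norm (((\<Sum>j\<in>UNIV. a j *\<^sub>R y j (\<tau> + t)) - (\<Sum>j\<in>UNIV. b j *\<^sub>R y j (\<tau> + t))) +
        ((y i (Suc (\<tau> + t)) - (\<Sum>j\<in>UNIV. a j *\<^sub>R y j (\<tau> + t))) -
        (y j (Suc (\<tau> + t)) - (\<Sum>j\<in>UNIV. b j *\<^sub>R y j (\<tau> + t))))) \<le> 1 * (2 * real t * \<beta>) + (\<beta> + \<beta>)"
      by (intro norm_triangle_le) simp
    then show ?case by (simp add: algebra_simps)
  qed
  show ?case
  \<comment> \<open>L steps until all agents lead, and L further ones for a contracting
    block.\<close>
  proof (cases "s \<le> \<tau> + 2 * L")
    case True
    then obtain t where t: "s = \<tau> + t" "t \<le> 2 * L" using less.prems(1) le_Suc_ex by auto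
    have "norm (y i s - y j s) \<le> 2 * real t * \<beta>" using short t by simp
    also have "\<dots> \<le> 4 * real L * \<beta>" using t \<beta> by (intro mult_right_mono) auto
    also have "\<dots> \<le> 4 * real L / \<eta> ^ L * \<beta>"
      using \<alpha> \<beta> by (intro mult_right_mono) (auto simp: field_simps mult_left_le)
    finally show ?thesis .
  next
    case False
    define n where "n = s - L"
    have n: "s = n + L" "n \<ge> \<tau> + L" "n < s" using False L_pos by (auto simp: n_def)
    have lead: "\<sigma> i k = level k" if "n \<le> k" "k \<le> s" for i k
    proof -
      define t where "t = k - (\<tau> + L)"
      have t: "k = \<tau> + L + t" using n that by (simp add: t_def)
      show ?thesis unfolding t by (rule all_leading) (use less.prems that t in auto)
    qed
    have "norm (y i (n + L) - y j (n + L)) \<le>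
        (1 - \<eta> ^ L) * (4 * real L / \<eta> ^ L * \<beta>) + 2 * real L * \<beta>"
    proof (rule spread_contracts)
      fix k i assume k: "n \<le> k" "k < n + L"
      have "y i (Suc k) = step_of i k"
        using lead[of k i] k n less.prems(2)[of k] by (intro leading_step) auto
      then show "norm (y i (Suc k) - (\<Sum>j\<in>UNIV. W k $ i $ j *\<^sub>R y j k)) \<le> \<beta>"
        using less.prems(3)[of k i] k n by simp
    next
      fix i j
      show "norm (y i n - y j n) \<le> 4 * real L / \<eta> ^ L * \<beta>"
        using n less.prems by (intro less.IH) auto
    qed
    also have "\<dots> = 4 * real L / \<eta> ^ L * \<beta> - 2 * real L * \<beta>"
    proof -
      have "\<eta> ^ L * (4 * real L / \<eta> ^ L * \<beta>) = 4 * real L * \<beta>" using eta by simp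
      then show ?thesis by (simp only: left_diff_distrib)
    qed
    also have "\<dots> \<le> 4 * real L / \<eta> ^ L * \<beta>" using \<beta> by simp
    finally show ?thesis using n by simp
  qed
qed

section \<open>Upcrossings forced by infinitely many resets\<close>

lemma level_tendsto:
  assumes "\<And>N. \<exists>k\<ge>N. level (Suc k) \<noteq> level k"
  shows "filterlim level at_top sequentially"
  unfolding filterlim_at_top
proof
  fix m
  have "\<exists>k. level k \<ge> m"
  proof (induction m)
    case (Suc m)
    then obtain k where k: "level k \<ge> m" by blast
    obtain k' where "k' \<ge> k" "level (Suc k') \<noteq> level k'" using assms by blast
    then have "level (Suc k') \<ge> Suc m" using level_mono[of k k'] level_Suc[of k'] k by simp
    then show ?case by blast
  qed auto
  then obtain k where "level k \<ge> m" by blast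
  then have "\<forall>k'\<ge>k. m \<le> level k'" using level_mono order_trans by blast
  then show "\<forall>\<^sub>F k in sequentially. m \<le> level k" by (auto simp: eventually_sequentially)
qed

lemma constant_between:
  assumes "\<And>k. a \<le> k \<Longrightarrow> k < b \<Longrightarrow> level (Suc k) = level k" "a \<le> b"
  shows "level b = level a"
  using assms(2,1) by (induction b rule: dec_induct) auto

text \<open>Uniform in z, so that the threshold for k can be fixed before it is known where the
  states are.\<close>

lemma perturbation_vanishes:
  assumes "F \<ge> 0" "\<beta> > 0"
  shows "\<forall>\<^sub>F k in sequentially. \<forall>i z. norm z \<le> F \<longrightarrow> norm (\<gamma> k *\<^sub>R (z + \<epsilon> i (Suc k))) \<le> \<beta>"
proof -
  have "(\<lambda>k. \<gamma> k * F) \<longlonglongrightarrow> 0 * F" by (intro tendsto_intros gamma_0)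
  then have "\<forall>\<^sub>F k in sequentially. \<gamma> k * F < \<beta> / 2" using assms by (intro order_tendstoD) auto
  moreover have "\<forall>\<^sub>F k in sequentially. \<forall>i. norm (\<gamma> k *\<^sub>R \<epsilon> i (Suc k)) < \<beta> / 2"
    using tendstoD[OF noise_vanishes, of "\<beta> / 2"] assms by (intro eventually_all_finite) simp
  ultimately show ?thesis
  proof eventually_elim
    case (elim k)
    have "norm (\<gamma> k *\<^sub>R (z + \<epsilon> i (Suc k))) \<le> \<beta>" if "norm z \<le> F" for i z
    proof -
      have "norm (\<gamma> k *\<^sub>R z) \<le> \<gamma> k * F" using that gamma_pos[of k] by (simp add: mult_left_mono)
      moreover have "norm (\<gamma> k *\<^sub>R \<epsilon> i (Suc k)) < \<beta> / 2" using elim by blast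
      ultimately have "norm (\<gamma> k *\<^sub>R z) + norm (\<gamma> k *\<^sub>R \<epsilon> i (Suc k)) \<le> \<beta>" using elim by linarith
      then show ?thesis unfolding scaleR_add_right by (rule norm_triangle_le)
    qed
    then show ?case by blast
  qed
qed

text \<open>Between two consecutive resets the states start at \<open>xstar\<close> and nearly agree; for the next
  reset to occur their average must leave the ball of radius \<open>c\<^sub>0\<close>, hence \<open>v\<close> climbs from
  \<open>v xstar\<close> to almost \<open>\<mu>\<close>.\<close>

lemma upcrossing_in_episode:
  assumes reset0: "\<And>i. y i \<tau> = xstar"
    and const: "\<And>k. \<tau> \<le> k \<Longrightarrow> k < q \<Longrightarrow> level (Suc k) = level k"
    and reset1: "level (Suc q) \<noteq> level q" and \<tau>q: "\<tau> \<le> q"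
    and F: "\<And>i z. norm z \<le> c\<^sub>0 + 2 \<Longrightarrow> norm (f i z) \<le> F"
    and pert: "\<And>k i z. k \<ge> \<tau> \<Longrightarrow> norm z \<le> F \<Longrightarrow> norm (\<gamma> k *\<^sub>R (z + \<epsilon> i (Suc k))) \<le> \<beta>"
    and \<beta>: "\<beta> > 0" and \<theta>: "\<theta> = (4 * real L / \<eta> ^ L + 1) * \<beta>" "\<theta> \<le> 1" "\<theta> \<le> e"
    and M: "M (level q) \<ge> c\<^sub>0 + 2"
    and near_xstar: "\<And>z. norm (z - xstar) \<le> \<theta> \<Longrightarrow> v z \<le> \<delta>1"
    and near_sphere: "\<And>z. c\<^sub>0 \<le> norm z \<Longrightarrow> norm z \<le> c\<^sub>0 + \<theta> \<Longrightarrow> \<delta>2 \<le> v z"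
    and \<delta>: "\<delta>1 < \<delta>2"
  shows "\<exists>n\<ge>\<tau>. \<exists>l>n. tracked (c\<^sub>0 + 2) e n l \<and> v (xb n) \<le> \<delta>1 \<and>
      (\<forall>s\<in>{n<..l}. \<delta>1 < v (xb s)) \<and> \<delta>2 \<le> v (xb l)"
proof -
  \<comment> \<open>D bounds the disagreement during the episode. One more perturbation gives
    \<open>\<theta>\<close>, the largest distance of a next state from the present average.\<close>
  define D where "D = 4 * real L / \<eta> ^ L * \<beta>"
  have D: "D \<ge> 0" "\<theta> = D + \<beta>" using \<beta> eta \<theta> by (auto simp: D_def algebra_simps)
  have pert': "norm (\<gamma> k *\<^sub>R (f i (y i k) + \<epsilon> i (Suc k))) \<le> \<beta>"
    if "k \<ge> \<tau>" "norm (y i k) \<le> c\<^sub>0 + 2" for i k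
    using pert that F by blast
  have spread: "norm (y i s - y j s) \<le> D"
    if "\<tau> \<le> s" "s \<le> q" "\<And>k i. \<tau> \<le> k \<Longrightarrow> k < s \<Longrightarrow> norm (y i k) \<le> c\<^sub>0 + 2" for s i j
    unfolding D_def using that \<beta> by (intro episode_spread[OF const reset0 pert']) auto
  have y_yb: "norm (y i s - yb s) \<le> D" if "\<And>i j. norm (y i s - y j s) \<le> D" for s i
    using norm_avg_diff_le[of "\<lambda>j. y j s" "y i s" D] that
    by (simp add: yb_def norm_minus_commute)
  \<comment> \<open>Bounded states give a small perturbation, hence small disagreement, hence
    bounded states again while the average is in the ball; induction over time breaks the
    circle.\<close>
  have inside: "norm (y i s) \<le> c\<^sub>0 + D"
    if "\<tau> \<le> s" "s \<le> q" "\<And>k. \<tau> \<le> k \<Longrightarrow> k \<le> s \<Longrightarrow> norm (yb k) < c\<^sub>0" for s i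
    using that
  proof (induction s arbitrary: i rule: less_induct)
    case (less s)
    have "norm (y i k) \<le> c\<^sub>0 + 2" if "\<tau> \<le> k" "k < s" for k i
      using less.IH[of k i] that less.prems \<theta>(2) D \<beta> by fastforce
    then have "norm (y i s - yb s) \<le> D" using less.prems spread by (intro y_yb) auto
    then show ?case using less.prems(3)[of s] less.prems(1) norm_triangle_ineq[of "y i s - yb s" "yb s"] by simp
  qed
  have next_near: "norm (y i (Suc k) - yb k) \<le> \<theta>"
    if k: "\<tau> \<le> k" "k < q" and small: "\<And>j. \<tau> \<le> j \<Longrightarrow> j \<le> k \<Longrightarrow> norm (yb j) < c\<^sub>0" for k i
  proof -
    have bdd: "norm (y i j) \<le> c\<^sub>0 + 2" if "\<tau> \<le> j" "j \<le> k" for i j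
      using inside[of j i] that k small \<theta>(2) D \<beta>
      by fastforce
    obtain a where a: "\<And>j. a j \<ge> 0" "(\<Sum>j\<in>UNIV. a j) = 1"
        "norm (y i (Suc k) - (\<Sum>j\<in>UNIV. a j *\<^sub>R y j k)) \<le> \<beta>"
      using approx_average[OF const[OF k] pert'[OF k(1) bdd[OF k(1) order_refl]] less_imp_le[OF \<beta>], of i]
      by blast
    have "norm (y j k - yb k) \<le> D" for j
      using k bdd by (intro y_yb spread) auto
    then have "norm ((\<Sum>j\<in>UNIV. a j *\<^sub>R y j k) - yb k) \<le> D" by (intro norm_convex_sum_le a)
    then show ?thesis
      using a(3) D norm_triangle_ineq[of "y i (Suc k) - (\<Sum>j\<in>UNIV. a j *\<^sub>R y j k)"
          "(\<Sum>j\<in>UNIV. a j *\<^sub>R y j k) - yb k"] by simp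
  qed
  \<comment> \<open>Otherwise every proposal at time q would have norm at most
    \<open>c\<^sub>0 + \<theta>\<close>, which is below the current bound, and the reset could not
    happen.\<close>
  have "\<exists>s. \<tau> \<le> s \<and> s \<le> q \<and> c\<^sub>0 \<le> norm (yb s)"
  proof (rule ccontr)
    assume "\<not> ?thesis"
    then have small: "\<And>s. \<tau> \<le> s \<Longrightarrow> s \<le> q \<Longrightarrow> norm (yb s) < c\<^sub>0" by force
    have y: "norm (y i q) \<le> c\<^sub>0 + D" for i using inside[of q i] \<tau>q small by simp
    obtain i where i: "norm (step_of i q) > M (level q)" using reset_cause[OF reset1] by blast
    have "norm ((\<Sum>j\<in>UNIV. W q $ i $ j *\<^sub>R y j q) - 0) \<le> c\<^sub>0 + D"
      using y by (intro norm_convex_sum_le weight_nonneg row_sum) simp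
    moreover have "norm (\<gamma> q *\<^sub>R (f i (y i q) + \<epsilon> i (Suc q))) \<le> \<beta>"
      using y[of i] \<tau>q \<theta>(2) D \<beta> by (intro pert') auto
    ultimately have "norm (step_of i q) \<le> c\<^sub>0 + D + \<beta>" by (intro norm_triangle_le) simp
    then show False using i M \<theta>(2) D by simp
  qed
  then obtain s0 where s0: "\<tau> \<le> s0" "s0 \<le> q" "c\<^sub>0 \<le> norm (yb s0)" by blast
  \<comment> \<open>First exit of the average from the ball. It overshoots the sphere by at most
    \<open>\<theta>\<close>, so v is still governed by its values on the sphere.\<close>
  define l where "l = (LEAST s. \<tau> \<le> s \<and> c\<^sub>0 \<le> norm (yb s))"
  have l: "\<tau> \<le> l" "c\<^sub>0 \<le> norm (yb l)"
    using LeastI[of "\<lambda>s. \<tau> \<le> s \<and> c\<^sub>0 \<le> norm (yb s)" s0] s0 by (auto simp: l_def)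
  have lq: "l \<le> q" using Least_le[of "\<lambda>s. \<tau> \<le> s \<and> c\<^sub>0 \<le> norm (yb s)" s0] s0 by (auto simp: l_def)
  have before: "norm (yb s) < c\<^sub>0" if "\<tau> \<le> s" "s < l" for s
    using not_less_Least[of s "\<lambda>s. \<tau> \<le> s \<and> c\<^sub>0 \<le> norm (yb s)"] that by (auto simp: l_def)
  have yb\<tau>: "yb \<tau> = xstar" by (simp add: yb_def reset0 avg_def sum_constant_scaleR del: sum_constant)
  then have "\<tau> \<noteq> l" using l(2) xstar_less by auto
  then have \<tau>l: "\<tau> < l" using l(1) by simp
  have bdd: "norm (y i s) \<le> c\<^sub>0 + D" if "\<tau> \<le> s" "s < l" for i s
    using before that lq by (intro inside) auto
  obtain l' where l': "l = Suc l'" "\<tau> \<le> l'" using \<tau>l by (cases l) auto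
  have y_l: "norm (y i l) \<le> c\<^sub>0 + \<theta>" for i
  proof -
    have "norm (y i (Suc l') - yb l') \<le> \<theta>" using l' lq before by (intro next_near) auto
    moreover have "norm (yb l') < c\<^sub>0" using before[of l'] l' by simp
    ultimately show ?thesis using norm_triangle_ineq[of "y i l - yb l'" "yb l'"] l' by simp
  qed
  have bdd': "norm (y i s) \<le> c\<^sub>0 + 2" if "\<tau> \<le> s" "s \<le> l" for i s
    using y_l[of i] bdd[of s i] that \<theta>(2) D \<beta> by (cases "s = l") auto
  have spread_l: "norm (y i s - y j s) \<le> D" if "\<tau> \<le> s" "s \<le> l" for i j s
    using that bdd' lq by (intro spread) auto
  have "norm (yb l) \<le> c\<^sub>0 + \<theta>" unfolding yb_def by (rule norm_avg_le[OF y_l])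
  then have vl: "\<delta>2 \<le> v (yb l)" using l(2) near_sphere by blast
  \<comment> \<open>Its maximum is the last time before the exit with v at most
    \<open>\<delta>1\<close>; the start of the episode, with the average at \<open>xstar\<close>,
    belongs to it.\<close>
  define A where "A = {s\<in>{\<tau>..l}. v (yb s) \<le> \<delta>1}"
  define n where "n = Max A"
  have A: "finite A" "\<tau> \<in> A" using \<tau>l yb\<tau> near_xstar[of xstar] D \<beta> by (auto simp: A_def)
  have "n \<in> A" unfolding n_def using A by (intro Max_in) auto
  moreover have "l \<notin> A" using vl \<delta> by (auto simp: A_def)
  ultimately have n: "\<tau> \<le> n" "n < l" "v (yb n) \<le> \<delta>1" by (auto simp: A_def order_le_less)
  have after: "\<delta>1 < v (yb s)" if "n < s" "s \<le> l" for s
  proof -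
    have "s \<notin> A" using Max_ge[OF A(1), of s] that by (auto simp: n_def)
    then show ?thesis using that n by (auto simp: A_def)
  qed
  \<comment> \<open>An agent lagging at s would be at \<open>xstar\<close> at time s + 1 and hold
    the average within D of it, against \<open>after\<close>.\<close>
  have lead: "\<sigma> i s = level s" if s: "n \<le> s" "s < l" for i s
  proof (rule ccontr)
    assume "\<sigma> i s \<noteq> level s"
    moreover have "level (Suc s) = level s" using s n lq by (intro const) auto
    ultimately have "y i (Suc s) = xstar" by (intro lagging_step)
    moreover have "norm (y i (Suc s) - yb (Suc s)) \<le> D"
      using s n by (intro y_yb spread_l) auto
    ultimately have "norm (yb (Suc s) - xstar) \<le> \<theta>" using D \<beta> by (simp add: norm_minus_commute)
    then have "v (yb (Suc s)) \<le> \<delta>1" by (rule near_xstar)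
    then show False using after[of "Suc s"] s by simp
  qed
  \<comment> \<open>At l itself no later time of the window is at hand; leading is inherited from
    the step before.\<close>
  have lead_l: "\<sigma> i s = level s" if s: "n \<le> s" "s \<le> l" for i s
  proof (cases "s = l")
    case True
    have "level (Suc l') = level l'" using l' lq by (intro const) auto
    from leading_step(2)[OF this lead[of l' i]] show ?thesis using True l' n by simp
  qed (use lead s in simp)
  then have xy: "x i s = y i s" if "n \<le> s" "s \<le> l" for i s using that by (simp add: y_def)
  then have xb: "xb s = yb s" if "n \<le> s" "s \<le> l" for s using that by (simp add: xb_def yb_def)
  have "tracked (c\<^sub>0 + 2) e n l"
    unfolding tracked_def
  proof (intro conjI ballI allI)
    show "n \<le> l" using n by simp
    show "regular_step s" if "s \<in> {n..<l}" for s
      using that n lq lead const by (intro regular_step_if_all_leading) auto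
    show "norm (x i s) \<le> c\<^sub>0 + 2" if "s \<in> {n..l}" for i s using that n bdd' by (simp add: xy)
    show "norm (x i s - x j s) \<le> e" if "s \<in> {n..l}" for i j s
      using that n spread_l[of s i j] \<theta>(3) D \<beta> by (simp add: xy)
  qed
  moreover have "v (xb n) \<le> \<delta>1" "\<forall>s\<in>{n<..l}. \<delta>1 < v (xb s)" "\<delta>2 \<le> v (xb l)"
    using n after vl by (auto simp: xb)
  ultimately show ?thesis using n by blast
qed

text \<open>Source of the levels that may serve as lower end of an upcrossing.\<close>

lemma gap:
  assumes "a < b"
  obtains d where "a < d" "d < b" "d \<notin> v ` root_set f"
proof -
  have "\<not> {a<..<b} \<subseteq> closure (v ` root_set f)"
  proof
    assume "{a<..<b} \<subseteq> closure (v ` root_set f)"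
    then have "{a<..<b} \<subseteq> interior (closure (v ` root_set f))" by (intro interior_maximal) auto
    then show False using nowhere_dense assms by simp
  qed
  then show ?thesis using that closure_subset by fastforce
qed

lemma v_near_point:
  assumes "v z < d"
  obtains \<rho> where "\<rho> > 0" "\<And>w. norm (w - z) < \<rho> \<Longrightarrow> v w < d"
proof -
  have "(v \<longlongrightarrow> v z) (nhds z)"
    using v_cont by (simp add: continuous_on_eq_continuous_at continuous_at tendsto_nhds_iff)
  from order_tendstoD(2)[OF this assms] show ?thesis
    using that unfolding eventually_nhds_metric dist_norm by blast
qed

text \<open>Compare z with its radial projection onto the sphere, at distance
  \<open>norm z - c\<^sub>0\<close>; uniform continuity on a slightly larger ball makes the width of
  the shell independent of z.\<close>

lemma v_near_sphere:
  assumes "d < \<mu>"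
  obtains \<rho> where "\<rho> > 0" "\<And>z. c\<^sub>0 \<le> norm z \<Longrightarrow> norm z < c\<^sub>0 + \<rho> \<Longrightarrow> d \<le> v z"
proof -
  have c0: "c\<^sub>0 > 0" using xstar_less norm_ge_zero[of xstar] by linarith
  have "uniformly_continuous_on (cball 0 (c\<^sub>0 + 1)) v"
    by (intro compact_uniformly_continuous continuous_on_subset[OF v_cont]) auto
  moreover have "\<mu> - d > 0" using assms by simp
  ultimately obtain \<rho> where \<rho>: "\<rho> > 0" "\<And>z w :: real ^ 'l. z \<in> cball 0 (c\<^sub>0 + 1) \<Longrightarrow> w \<in> cball 0 (c\<^sub>0 + 1) \<Longrightarrow>
      dist w z < \<rho> \<Longrightarrow> dist (v w) (v z) < \<mu> - d"
    by (rule uniformly_continuous_onE) blast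
  show ?thesis
  proof
    show "min 1 \<rho> > 0" using \<rho> by simp
    fix z :: "real ^ 'l" assume z: "c\<^sub>0 \<le> norm z" "norm z < c\<^sub>0 + min 1 \<rho>"
    define w where "w = (c\<^sub>0 / norm z) *\<^sub>R z"
    have z0: "norm z > 0" using z c0 by linarith
    have w: "norm w = c\<^sub>0" using z0 c0 by (simp add: w_def)
    have "z - w = (1 - c\<^sub>0 / norm z) *\<^sub>R z" by (simp add: w_def scaleR_diff_left)
    then have "norm (z - w) = \<bar>1 - c\<^sub>0 / norm z\<bar> * norm z" by simp
    also have "\<dots> = norm z - c\<^sub>0" using z z0 by (simp add: field_simps)
    finally have "dist w z < \<rho>" using z by (simp add: dist_norm norm_minus_commute)
    then have "dist (v w) (v z) < \<mu> - d" using \<rho>(2)[of z w] z w by simp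
    then show "d \<le> v z" using v_sphere[OF w] by (simp add: dist_real_def)
  qed
qed

lemma level_eventually_constant: "\<exists>N. \<forall>k\<ge>N. level (Suc k) = level k"
proof (rule ccontr)
  assume "\<not> ?thesis"
  then have unb: "\<And>N. \<exists>k\<ge>N. level (Suc k) \<noteq> level k" by blast
  \<comment> \<open>The lower level separates the value at \<open>xstar\<close> from the values on
    the sphere; the midpoint \<open>\<delta>2\<close> leaves room for the overshoot.\<close>
  obtain \<delta>1 where \<delta>1: "v xstar < \<delta>1" "\<delta>1 < \<mu>" "\<delta>1 \<notin> v ` root_set f"
    by (rule gap[OF v_xstar])
  define \<delta>2 where "\<delta>2 = (\<delta>1 + \<mu>) / 2"
  have \<delta>2: "\<delta>1 < \<delta>2" "\<delta>2 < \<mu>" using \<delta>1 by (auto simp: \<delta>2_def)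
  obtain \<rho>1 where \<rho>1: "\<rho>1 > 0" "\<And>w. norm (w - xstar) < \<rho>1 \<Longrightarrow> v w < \<delta>1"
    using v_near_point[OF \<delta>1(1)] by blast
  obtain \<rho>2 where \<rho>2: "\<rho>2 > 0" "\<And>z. c\<^sub>0 \<le> norm z \<Longrightarrow> norm z < c\<^sub>0 + \<rho>2 \<Longrightarrow> \<delta>2 \<le> v z"
    using v_near_sphere[OF \<delta>2(2)] by blast
  obtain F where F: "F \<ge> 0" "\<And>i z. norm z \<le> c\<^sub>0 + 2 \<Longrightarrow> norm (f i z) \<le> F"
    using bounded_on_cball[of f "c\<^sub>0 + 2", OF f_cont] by blast
  show False
  proof (rule no_upcrossing[OF \<delta>2(1) \<delta>1(3)])
    fix e :: real and N assume e: "e > 0"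
    \<comment> \<open>One tolerance for the disagreement, the closeness to \<open>xstar\<close> and
      the overshoot; the halves make the comparison with both radii strict. \<open>\<beta>\<close>
      is then dictated by the constant of \<open>episode_spread\<close>.\<close>
    define \<theta> where "\<theta> = min (min 1 e) (min (\<rho>1 / 2) (\<rho>2 / 2))"
    define \<beta> where "\<beta> = \<theta> / (4 * real L / \<eta> ^ L + 1)"
    have \<theta>: "\<theta> > 0" "\<theta> \<le> 1" "\<theta> \<le> e" "\<theta> < \<rho>1" "\<theta> < \<rho>2"
      using e \<rho>1(1) \<rho>2(1) by (auto simp: \<theta>_def min_def)
    have "4 * real L / \<eta> ^ L + 1 > 0" using eta by (simp add: add_nonneg_pos)
    then have \<beta>: "\<beta> > 0" "\<theta> = (4 * real L / \<eta> ^ L + 1) * \<beta>" using \<theta>(1) by (auto simp: \<beta>_def)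
    obtain K1 where K1: "\<And>k i z. k \<ge> K1 \<Longrightarrow> norm z \<le> F \<Longrightarrow> norm (\<gamma> k *\<^sub>R (z + \<epsilon> i (Suc k))) \<le> \<beta>"
      using perturbation_vanishes[OF F(1) \<beta>(1)] by (auto simp: eventually_sequentially)
    \<comment> \<open>Infinitely many resets push the truncation bounds beyond
      \<open>c\<^sub>0 + 2\<close>.\<close>
    have "filterlim (\<lambda>k. M (level k)) at_top sequentially"
      using filterlim_compose[OF M_lim level_tendsto[OF unb]] .
    then obtain K2 where K2: "\<And>k. k \<ge> K2 \<Longrightarrow> c\<^sub>0 + 2 \<le> M (level k)"
      by (auto simp: filterlim_at_top eventually_sequentially)
    obtain k where k: "k \<ge> N + K1 + K2" "level (Suc k) \<noteq> level k" using unb by blast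
    \<comment> \<open>The episode runs from a late reset at k to the next one at q.\<close>
    define q where "q = (LEAST q. Suc k \<le> q \<and> level (Suc q) \<noteq> level q)"
    have q: "Suc k \<le> q" "level (Suc q) \<noteq> level q"
      using LeastI_ex[of "\<lambda>q. Suc k \<le> q \<and> level (Suc q) \<noteq> level q"] unb[of "Suc k"]
      by (auto simp: q_def)
    have const: "level (Suc j) = level j" if "Suc k \<le> j" "j < q" for j
      using not_less_Least[of j "\<lambda>q. Suc k \<le> q \<and> level (Suc q) \<noteq> level q"] that
      by (auto simp: q_def)
    have "\<exists>n\<ge>Suc k. \<exists>l>n. tracked (c\<^sub>0 + 2) e n l \<and> v (xb n) \<le> \<delta>1 \<and>
        (\<forall>s\<in>{n<..l}. \<delta>1 < v (xb s)) \<and> \<delta>2 \<le> v (xb l)"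
    proof (rule upcrossing_in_episode[where q = q and F = F and \<beta> = \<beta> and \<theta> = \<theta>])
      show "v z \<le> \<delta>1" if "norm (z - xstar) \<le> \<theta>" for z using \<rho>1(2)[of z] that \<theta> by simp
      show "\<delta>2 \<le> v z" if "c\<^sub>0 \<le> norm z" "norm z \<le> c\<^sub>0 + \<theta>" for z using \<rho>2(2)[of z] that \<theta> by simp
      show "y i (Suc k) = xstar" for i using reset[OF k(2)] .
      show "norm (\<gamma> j *\<^sub>R (z + \<epsilon> i (Suc j))) \<le> \<beta>" if "Suc k \<le> j" "norm z \<le> F" for j i z
        using K1 that k by simp
      show "c\<^sub>0 + 2 \<le> M (level q)" using K2[of q] k q by simp
    qed (use const q F(2) \<beta> \<theta> \<delta>2 in auto)
    then obtain n where n: "n \<ge> Suc k" "\<exists>l>n. tracked (c\<^sub>0 + 2) e n l \<and> v (xb n) \<le> \<delta>1 \<and>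
        (\<forall>s\<in>{n<..l}. \<delta>1 < v (xb s)) \<and> \<delta>2 \<le> v (xb l)" by blast
    then show "\<exists>n\<ge>N. \<exists>l>n. tracked (c\<^sub>0 + 2) e n l \<and> v (xb n) \<le> \<delta>1 \<and>
        (\<forall>s\<in>{n<..l}. \<delta>1 < v (xb s)) \<and> \<delta>2 \<le> v (xb l)"
      using k by (intro exI[of _ n]) auto
  qed
qed

end

section \<open>Convergence\<close>

lemma subsequence_of_infinitely_often:
  assumes "\<And>N :: nat. \<exists>k\<ge>N. Q k"
  shows "\<exists>r :: nat \<Rightarrow> nat. strict_mono r \<and> (\<forall>k. Q (r k))"
proof -
  have "infinite {k. Q k}"
    unfolding infinite_nat_iff_unbounded_le using assms by auto
  from infinite_enumerate[OF this] show ?thesis by auto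
qed

lemma tendsto_if_unique_limit_point:
  fixes a :: "nat \<Rightarrow> 'a::heine_borel"
  assumes bdd: "bounded (range a)"
    and uniq: "\<And>r z. strict_mono r \<Longrightarrow> (\<lambda>k. a (r k)) \<longlonglongrightarrow> z \<Longrightarrow> z = l"
  shows "a \<longlonglongrightarrow> l"
proof (rule ccontr)
  assume "\<not> ?thesis"
  then obtain e where e: "e > 0" "\<And>N. \<exists>k\<ge>N. \<not> dist (a k) l < e"
    unfolding tendsto_iff eventually_sequentially by blast
  obtain r :: "nat \<Rightarrow> nat" where r: "strict_mono r" "\<And>k. \<not> dist (a (r k)) l < e"
    using subsequence_of_infinitely_often[of "\<lambda>k. \<not> dist (a k) l < e", OF e(2)] by blast
  have "bounded (range (\<lambda>k. a (r k)))" using bdd by (rule bounded_subset) auto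
  from bounded_imp_convergent_subsequence[OF this] obtain z r' where
    r': "strict_mono r'" "(\<lambda>k. a (r (r' k))) \<longlonglongrightarrow> z" by (auto simp: o_def)
  have "z = l" using uniq[OF strict_mono_o[OF r(1) r'(1)], of z] r'(2) by (simp add: o_def)
  then have "\<forall>\<^sub>F k in sequentially. dist (a (r (r' k))) l < e" using tendstoD[OF r'(2) e(1)] by simp
  then show False using r(2) by (auto simp: eventually_sequentially)
qed

lemma infdist_tendsto_0:
  fixes a :: "nat \<Rightarrow> 'a::heine_borel"
  assumes bdd: "bounded (range a)"
    and lim: "\<And>r z. strict_mono r \<Longrightarrow> (\<lambda>k. a (r k)) \<longlonglongrightarrow> z \<Longrightarrow> z \<in> S"
  shows "(\<lambda>k. infdist (a k) S) \<longlonglongrightarrow> 0"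
proof (rule ccontr)
  assume "\<not> ?thesis"
  then obtain e where e: "e > 0" "\<And>N. \<exists>k\<ge>N. \<not> dist (infdist (a k) S) 0 < e"
    unfolding tendsto_iff eventually_sequentially by blast
  obtain r :: "nat \<Rightarrow> nat" where r: "strict_mono r" "\<And>k. \<not> dist (infdist (a (r k)) S) 0 < e"
    using subsequence_of_infinitely_often[of "\<lambda>k. \<not> dist (infdist (a k) S) 0 < e", OF e(2)] by blast
  have "bounded (range (\<lambda>k. a (r k)))" using bdd by (rule bounded_subset) auto
  from bounded_imp_convergent_subsequence[OF this] obtain z r' where
    r': "strict_mono r'" "(\<lambda>k. a (r (r' k))) \<longlonglongrightarrow> z" by (auto simp: o_def)
  have "z \<in> S" using lim[OF strict_mono_o[OF r(1) r'(1)], of z] r'(2) by (simp add: o_def)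
  obtain k where "dist (a (r (r' k))) z < e"
    using tendstoD[OF r'(2) e(1)] by (auto simp: eventually_sequentially)
  then have "infdist (a (r (r' k))) S < e" using infdist_le[OF \<open>z \<in> S\<close>, of "a (r (r' k))"] by simp
  then show False using r(2)[of "r' k"] infdist_nonneg[of "a (r (r' k))" S] by simp
qed

text \<open>The omega-limit set; as an intersection of closed tails it is closed at once.\<close>

definition limit_set :: "(nat \<Rightarrow> 'a::topological_space) \<Rightarrow> 'a set" where
  "limit_set a = (\<Inter>N. closure (a ` {N..}))"

lemma mem_limit_set:
  fixes a :: "nat \<Rightarrow> 'a::metric_space"
  shows "z \<in> limit_set a \<longleftrightarrow> (\<forall>e>0. \<forall>N. \<exists>k\<ge>N. dist (a k) z < e)"
  by (simp add: limit_set_def closure_approachable Bex_def) blast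

lemma subsequential_limit_in_limit_set:
  fixes a :: "nat \<Rightarrow> 'a::metric_space"
  assumes "strict_mono r" "(\<lambda>k. a (r k)) \<longlonglongrightarrow> z"
  shows "z \<in> limit_set a"
  unfolding mem_limit_set
proof (intro allI impI)
  fix e :: real and N assume "e > 0"
  from tendstoD[OF assms(2) this] obtain K where K: "\<And>k. k \<ge> K \<Longrightarrow> dist (a (r k)) z < e"
    by (auto simp: eventually_sequentially)
  show "\<exists>k\<ge>N. dist (a k) z < e"
    using K[of "K + N"] seq_suble[OF assms(1), of "K + N"] by (intro exI[of _ "r (K + N)"]) auto
qed

lemma limit_set_nonempty:
  fixes a :: "nat \<Rightarrow> 'a::heine_borel"
  assumes "bounded (range a)"
  shows "limit_set a \<noteq> {}"
proof -
  obtain z r where "strict_mono r" "(\<lambda>k. a (r k)) \<longlonglongrightarrow> z"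
    using bounded_imp_convergent_subsequence[OF assms] by (auto simp: o_def)
  from subsequential_limit_in_limit_set[OF this] show ?thesis by auto
qed

text \<open>If it split into closed pieces at distance d, the sequence would eventually be within d
  / 3 of their union and move by less than d / 3 per step. It could then never change from one piece
  to the other, yet it comes close to both infinitely often.\<close>

lemma connected_limit_set:
  fixes a :: "nat \<Rightarrow> 'a::heine_borel"
  assumes bdd: "bounded (range a)" and inc: "(\<lambda>k. dist (a (Suc k)) (a k)) \<longlonglongrightarrow> 0"
  shows "connected (limit_set a)"
proof (rule ccontr)
  let ?S = "limit_set a"
  assume "\<not> connected ?S"
  then obtain A B where AB: "closed A" "closed B" "?S \<subseteq> A \<union> B" "A \<inter> B \<inter> ?S = {}" "A \<inter> ?S \<noteq> {}" "B \<inter> ?S \<noteq> {}"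
    unfolding connected_closed by blast
  have S: "closed ?S" unfolding limit_set_def by auto
  have "?S \<subseteq> closure (range a)" unfolding limit_set_def by (metis INF_lower UNIV_I atLeast_0)
  then have "bounded ?S" using bounded_subset[OF bounded_closure[OF bdd]] by blast
  then have "compact (A \<inter> ?S)" "closed (B \<inter> ?S)" using S AB
    by (auto simp: compact_eq_bounded_closed intro: bounded_subset)
  moreover have "(A \<inter> ?S) \<inter> (B \<inter> ?S) = {}" using AB by auto
  ultimately obtain d where d: "d > 0" "\<And>p q. p \<in> A \<inter> ?S \<Longrightarrow> q \<in> B \<inter> ?S \<Longrightarrow> d \<le> dist p q"
    using separate_compact_closed by metis
  have d3: "d / 3 > 0" using d by simp
  have "(\<lambda>k. infdist (a k) ?S) \<longlonglongrightarrow> 0"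
    using bdd subsequential_limit_in_limit_set by (rule infdist_tendsto_0)
  from eventually_conj[OF tendstoD[OF this d3] tendstoD[OF inc d3]]
  obtain N where N: "\<And>k. k \<ge> N \<Longrightarrow> infdist (a k) ?S < d / 3" "\<And>k. k \<ge> N \<Longrightarrow> dist (a (Suc k)) (a k) < d / 3"
    by (auto simp: eventually_sequentially infdist_nonneg)
  obtain p q where p: "p \<in> A \<inter> ?S" and q: "q \<in> B \<inter> ?S" using AB by auto
  have S_ne: "?S \<noteq> {}" using p by auto
  obtain k1 where k1: "k1 \<ge> N" "dist (a k1) p < d / 3" using p d3 mem_limit_set[of p a] by blast
  have stay: "\<exists>p\<in>A \<inter> ?S. dist (a k) p < d / 3" if "k \<ge> k1" for k
    using that
  proof (induction k rule: dec_induct)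
    case base
    then show ?case using k1 p by blast
  next
    case (step k)
    then obtain p where p: "p \<in> A \<inter> ?S" "dist (a k) p < d / 3" by blast
    have "infdist (a (Suc k)) ?S < d / 3" using N(1)[of "Suc k"] step k1 by simp
    then obtain s where s: "s \<in> ?S" "dist (a (Suc k)) s < d / 3"
      using S_ne cInf_lessD[of "(\<lambda>y. dist (a (Suc k)) y) ` ?S" "d / 3"]
      by (auto simp: infdist_notempty)
    have "dist (a (Suc k)) (a k) < d / 3" using N(2)[of k] step k1 by simp
    then have "dist p s < d"
      using p(2) s(2) dist_triangle[of p s "a k"] dist_triangle[of "a k" s "a (Suc k)"]
      by (simp add: dist_commute)
    then have "s \<in> A \<inter> ?S" using d(2)[OF p(1), of s] s AB(3) by auto
    then show ?case using s by blast
  qed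
  obtain k2 where k2: "k2 \<ge> k1" "dist (a k2) q < d / 3" using q d3 mem_limit_set[of q a] by blast
  obtain p' where p': "p' \<in> A \<inter> ?S" "dist (a k2) p' < d / 3" using stay[OF k2(1)] by blast
  have "dist p' q < d"
    using p'(2) k2(2) d3 dist_triangle[of p' q "a k2"] by (simp add: dist_commute)
  then show False using d(2)[OF p'(1) q] by simp
qed

section \<open>Stacked vectors and Kronecker products\<close>

lemma kronecker_identity_col:
  fixes A :: "real ^ 'n::finite ^ 'n" and y :: "'n \<Rightarrow> real ^ 'l::finite"
  shows "(A \<otimes>\<^sub>K (mat 1 :: real ^ 'l ^ 'l)) *v col y = col (\<lambda>i. \<Sum>j\<in>UNIV. A $ i $ j *\<^sub>R y j)"
proof -
  have "((A \<otimes>\<^sub>K (mat 1 :: real ^ 'l ^ 'l)) *v col y) $ (i, b) = col (\<lambda>i. \<Sum>j\<in>UNIV. A $ i $ j *\<^sub>R y j) $ (i, b)" for i b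
  proof -
    have "((A \<otimes>\<^sub>K (mat 1 :: real ^ 'l ^ 'l)) *v col y) $ (i, b) =
        (\<Sum>q\<in>UNIV \<times> UNIV. A $ i $ fst q * mat 1 $ b $ snd q * y (fst q) $ snd q)"
      by (simp add: matrix_vector_mult_def kronecker_def col_def)
    also have "\<dots> = (\<Sum>j\<in>UNIV. \<Sum>c\<in>UNIV. A $ i $ j * mat 1 $ b $ c * y j $ c)"
      by (simp add: sum.cartesian_product case_prod_beta)
    also have "\<dots> = (\<Sum>j\<in>UNIV. \<Sum>c\<in>UNIV. if c = b then A $ i $ j * y j $ c else 0)"
      by (intro sum.cong) (auto simp: mat_def)
    finally show ?thesis by (simp add: col_def)
  qed
  then show ?thesis by (auto simp: vec_eq_iff)
qed

lemma D_perp_col: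
  fixes y :: "'n::finite \<Rightarrow> real ^ 'l::finite"
  shows "D_perp *v col y = col (\<lambda>i. y i - avg y)"
proof -
  have "(\<Sum>j\<in>UNIV. (mat 1 - (1 / real CARD('n)) *\<^sub>R (\<chi> i j. 1 :: real ^ 'n ^ 'n)) $ i $ j *\<^sub>R y j) = y i - avg y" for i
  proof -
    have "(\<Sum>j\<in>UNIV. (mat 1 - (1 / real CARD('n)) *\<^sub>R (\<chi> i j. 1 :: real ^ 'n ^ 'n)) $ i $ j *\<^sub>R y j) =
      (\<Sum>j\<in>UNIV. (if j = i then y j else 0) - (1 / real CARD('n)) *\<^sub>R y j)"
      by (intro sum.cong) (auto simp: mat_def scaleR_diff_left)
    then show ?thesis by (simp add: sum_subtractf avg_alt)
  qed
  then show ?thesis unfolding D_perp_def kronecker_identity_col by simp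
qed

lemma closed_root_set:
  assumes "\<And>i. continuous_on UNIV (f i)"
  shows "closed (root_set f)"
proof -
  have "root_set f = (\<lambda>z. avg (\<lambda>i. f i z)) -` {0}" by (auto simp: root_set_def)
  moreover have "continuous_on UNIV (\<lambda>z. avg (\<lambda>i. f i z))"
    unfolding avg_def by (intro continuous_intros assms)
  ultimately show ?thesis by (simp add: continuous_on_closed_vimage[of UNIV] closed_vimage)
qed

section \<open>Behaviour after the last reset\<close>

context dsaawet_path
begin

text \<open>Once the maximum has settled, L steps make all agents lead. One more step gives the
  bound, which holds for states that have just passed the truncation test, and makes the index
  positive.\<close>

lemma eventually_regular:
  "\<exists>k0>0. \<exists>R. (\<forall>k\<ge>k0. regular_step k) \<and> (\<forall>k\<ge>k0. \<forall>i. norm (x i k) \<le> R)"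
proof -
  obtain N where N: "\<And>k. k \<ge> N \<Longrightarrow> level (Suc k) = level k" using level_eventually_constant by blast
  have lead: "\<sigma> i k = level k" if "k \<ge> N + L" for i k
    using all_leading[of N "k - (N + L)" i] N that by simp
  show ?thesis
  proof (intro exI[of _ "N + L + 1"] exI[of _ "M (level N)"] conjI allI impI)
    show "regular_step k" if "k \<ge> N + L + 1" for k
      using that by (intro regular_step_if_all_leading N lead) auto
    show "norm (x i k) \<le> M (level N)" if k: "k \<ge> N + L + 1" for i k
    proof -
      obtain k' where k': "k = Suc k'" "k' \<ge> N + L" using k by (cases k) auto
      have "norm (y i (Suc k')) \<le> M (level k')" using k' by (intro leading_step N lead) auto
      moreover have "level k' = level N" using k' by (intro constant_between[of N k']) (auto simp: N)
      moreover have "x i k = y i k" using lead[of k i] k by (simp add: y_def)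
      ultimately show ?thesis using k' by simp
    qed
  qed simp
qed

lemma consensus:
  assumes "e > 0"
  shows "\<forall>\<^sub>F k in sequentially. \<forall>i j. norm (x i k - x j k) \<le> e"
proof -
  obtain k0 R where reg: "\<And>k. k \<ge> k0 \<Longrightarrow> regular_step k" and bdd: "\<And>i k. k \<ge> k0 \<Longrightarrow> norm (x i k) \<le> R"
    using eventually_regular by blast
  obtain F where F: "F \<ge> 0" "\<And>i z. norm z \<le> R \<Longrightarrow> norm (f i z) \<le> F"
    using bounded_on_cball[of f R, OF f_cont] by blast
  \<comment> \<open>Summing the noise norms over the agents gives a single null sequence that serves
    all of them.\<close>
  define b where "b = (\<lambda>k. \<gamma> k * F + (\<Sum>i\<in>UNIV. norm (\<gamma> k *\<^sub>R \<epsilon> i (Suc k))))"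
  have "b \<longlonglongrightarrow> 0 * F + (\<Sum>i\<in>(UNIV :: 'n set). norm (0 :: real ^ 'l))"
    unfolding b_def by (intro tendsto_intros gamma_0 noise_vanishes)
  then have b: "b \<longlonglongrightarrow> 0" by simp
  show ?thesis
  proof (rule spread_tendsto_0[OF bdd _ b assms])
    fix k i assume k: "k \<ge> k0"
    have "norm (\<gamma> k *\<^sub>R f i (x i k)) \<le> \<gamma> k * F"
      using F(2)[OF bdd[OF k]] gamma_pos[of k] by (simp add: mult_left_mono)
    moreover have "norm (\<gamma> k *\<^sub>R \<epsilon> i (Suc k)) \<le> (\<Sum>i\<in>UNIV. norm (\<gamma> k *\<^sub>R \<epsilon> i (Suc k)))"
      by (rule member_le_sum[of i UNIV "\<lambda>i. norm (\<gamma> k *\<^sub>R \<epsilon> i (Suc k))"]) auto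
    ultimately have "norm (\<gamma> k *\<^sub>R f i (x i k) + \<gamma> k *\<^sub>R \<epsilon> i (Suc k)) \<le> b k"
      unfolding b_def by (intro norm_triangle_le) simp
    then show "norm (x i (Suc k) - (\<Sum>j\<in>UNIV. W k $ i $ j *\<^sub>R x j k)) \<le> b k"
      using reg[OF k] by (simp add: regular_step_def scaleR_add_right)
  qed
qed

lemma bounded_x: "bounded (range (x i))"
proof -
  obtain k0 R where bdd: "\<And>i k. k \<ge> k0 \<Longrightarrow> norm (x i k) \<le> R" using eventually_regular by blast
  have "bounded (x i ` {k0..})" using bdd by (auto intro!: boundedI[where B = R])
  moreover have "(UNIV :: nat set) = {..<k0} \<union> {k0..}" by auto
  ultimately show ?thesis by (metis bounded_Un finite_imp_bounded finite_imageI finite_lessThan image_Un)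
qed

lemma bounded_xb: "bounded (range xb)"
proof -
  have "\<exists>R. \<forall>i k. norm (x i k) \<le> R"
  proof -
    have "\<exists>R. \<forall>k. norm (x i k) \<le> R" for i using bounded_x[of i] by (auto simp: bounded_iff)
    then obtain R where R: "\<And>i k. norm (x i k) \<le> R i" by metis
    have "norm (x i k) \<le> (\<Sum>i\<in>UNIV. \<bar>R i\<bar>)" for i k
      using R[of i k] member_le_sum[of i UNIV "\<lambda>i. \<bar>R i\<bar>"] by simp
    then show ?thesis by blast
  qed
  then obtain R where "\<And>i k. norm (x i k) \<le> R" by blast
  then show ?thesis by (intro boundedI[of _ R]) (auto simp: xb_def intro!: norm_avg_le)
qed

lemma xb_increments: "(\<lambda>k. dist (xb (Suc k)) (xb k)) \<longlonglongrightarrow> 0"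
proof -
  obtain k0 R where reg: "\<And>k. k \<ge> k0 \<Longrightarrow> regular_step k" and bdd: "\<And>i k. k \<ge> k0 \<Longrightarrow> norm (x i k) \<le> R"
    using eventually_regular by blast
  have "norm (x i k - x j k) \<le> 2 * R" if "k \<ge> k0" for i j k
    using norm_triangle_ineq4[of "x i k" "x j k"] bdd[OF that, of i] bdd[OF that, of j] by simp
  then have "tracked R (2 * R) (k + k0) (Suc (k + k0))" for k
    using reg bdd by (auto simp: tracked_def)
  then have "(\<lambda>k. xb (Suc (k + k0)) - xb (k + k0)) \<longlonglongrightarrow> 0"
    by (intro increment_tendsto_0) (auto simp: strict_mono_def)
  then have "(\<lambda>k. xb (Suc k) - xb k) \<longlonglongrightarrow> 0"
    using LIMSEQ_offset[of "\<lambda>k. xb (Suc k) - xb k" k0 0] by simp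
  from tendsto_norm[OF this] show ?thesis by (simp add: dist_norm)
qed

text \<open>Two limit values of v would enclose a level outside v(J) that is crossed upwards in
  arbitrarily late windows.\<close>

lemma v_converges: "convergent (\<lambda>k. v (xb k))"
proof (rule ccontr)
  let ?a = "\<lambda>k. v (xb k)"
  assume div: "\<not> convergent ?a"
  have bdd_a: "bounded (range ?a)"
  proof -
    have "compact (v ` closure (range xb))"
      using bounded_xb by (intro compact_continuous_image continuous_on_subset[OF v_cont]) (auto simp: compact_closure)
    moreover have "range ?a \<subseteq> v ` closure (range xb)" using closure_subset by blast
    ultimately show ?thesis using bounded_subset[OF compact_imp_bounded] by blast
  qed
  from bounded_imp_convergent_subsequence[OF this] obtain l r where
    r: "strict_mono r" "(\<lambda>k. ?a (r k)) \<longlonglongrightarrow> l" by (auto simp: o_def)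
  have "\<not> ?a \<longlonglongrightarrow> l" using div by (auto simp: convergent_def)
  then obtain r' l' where r': "strict_mono r'" "(\<lambda>k. ?a (r' k)) \<longlonglongrightarrow> l'" "l' \<noteq> l"
    using tendsto_if_unique_limit_point[OF bdd_a] by blast
  define lo hi where "lo = min l l'" and "hi = max l l'"
  have lohi: "lo < hi" using r'(3) by (auto simp: lo_def hi_def)
  have in_set: "lo \<in> limit_set ?a" "hi \<in> limit_set ?a"
    using subsequential_limit_in_limit_set[of r ?a, OF r]
      subsequential_limit_in_limit_set[of r' ?a, OF r'(1,2)] by (auto simp: lo_def hi_def min_def max_def)
  obtain \<delta>1 where \<delta>1: "lo < \<delta>1" "\<delta>1 < hi" "\<delta>1 \<notin> v ` root_set f" by (rule gap[OF lohi])
  define \<delta>2 where "\<delta>2 = (\<delta>1 + hi) / 2"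
  have \<delta>2: "\<delta>1 < \<delta>2" "\<delta>2 < hi" using \<delta>1 by (auto simp: \<delta>2_def)
  have below: "\<exists>k\<ge>N. ?a k < \<delta>1" for N
  proof -
    have "\<delta>1 - lo > 0" using \<delta>1 by simp
    then obtain k where "k \<ge> N" "dist (?a k) lo < \<delta>1 - lo" using in_set(1) unfolding mem_limit_set by blast
    then show ?thesis by (intro exI[of _ k]) (simp add: dist_real_def)
  qed
  have above: "\<exists>k\<ge>N. \<delta>2 < ?a k" for N
  proof -
    have "hi - \<delta>2 > 0" using \<delta>2 by simp
    then obtain k where "k \<ge> N" "dist (?a k) hi < hi - \<delta>2" using in_set(2) unfolding mem_limit_set by blast
    then show ?thesis by (intro exI[of _ k]) (simp add: dist_real_def)
  qed
  obtain k0 R where reg: "\<And>k. k \<ge> k0 \<Longrightarrow> regular_step k" and bdd: "\<And>i k. k \<ge> k0 \<Longrightarrow> norm (x i k) \<le> R"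
    using eventually_regular by blast
  show False
  proof (rule no_upcrossing[OF \<delta>2(1) \<delta>1(3)])
    fix e :: real and N assume "e > 0"
    then obtain K where K: "\<And>k i j. k \<ge> K \<Longrightarrow> norm (x i k - x j k) \<le> e"
      using consensus[of e] unfolding eventually_sequentially by blast
    obtain a where a: "a \<ge> N + K + k0" "?a a < \<delta>1" using below by blast
    obtain l where l: "l \<ge> a" "\<delta>2 < ?a l" using above by blast
    \<comment> \<open>Cutting at the last time with value at most \<open>\<delta>1\<close> leaves a
      window on whose remainder v stays above that level.\<close>
    define A where "A = {s\<in>{a..l}. ?a s \<le> \<delta>1}"
    define n where "n = Max A"
    have A: "finite A" "a \<in> A" using a l by (auto simp: A_def)
    have "n \<in> A" unfolding n_def using A by (intro Max_in) auto
    moreover have "l \<notin> A" using l \<delta>2 by (auto simp: A_def)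
    ultimately have n: "a \<le> n" "n < l" "?a n \<le> \<delta>1" by (auto simp: A_def order_le_less)
    have after: "\<delta>1 < ?a s" if "n < s" "s \<le> l" for s
    proof -
      have "s \<notin> A" using Max_ge[OF A(1), of s] that by (auto simp: n_def)
      then show ?thesis using that n by (auto simp: A_def)
    qed
    have "tracked R e n l" using n a reg bdd K by (auto simp: tracked_def)
    then show "\<exists>n\<ge>N. \<exists>l>n. tracked R e n l \<and> ?a n \<le> \<delta>1 \<and> (\<forall>s\<in>{n<..l}. \<delta>1 < ?a s) \<and> \<delta>2 \<le> ?a l"
      using n a l after by (intro exI[of _ n] exI[of _ l] conjI) auto
  qed
qed

lemma infdist_xb: "(\<lambda>k. infdist (xb k) (root_set f)) \<longlonglongrightarrow> 0"
proof (rule infdist_tendsto_0[OF bounded_xb])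
  fix r z assume r: "strict_mono r" "(\<lambda>k. xb (r k)) \<longlonglongrightarrow> z"
  obtain k0 R where reg: "\<And>k. k \<ge> k0 \<Longrightarrow> regular_step k" and bdd: "\<And>i k. k \<ge> k0 \<Longrightarrow> norm (x i k) \<le> R"
    using eventually_regular by blast
  obtain V where "(\<lambda>k. v (xb k)) \<longlonglongrightarrow> V" using v_converges by (auto simp: convergent_def)
  from limit_point_is_root[OF reg bdd consensus this r] show "z \<in> root_set f" .
qed

text \<open>\<open>infdist\<close> to the empty set is 0 by convention; for a nonempty closed set
  distance 0 means membership.\<close>

lemma limit_set_subset:
  assumes "root_set f \<noteq> {}"
  shows "limit_set xb \<subseteq> root_set f"
proof
  fix z assume z: "z \<in> limit_set xb"
  have "infdist z (root_set f) \<le> 0"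
  proof (rule field_le_epsilon)
    fix e :: real assume "e > 0"
    then have e: "e / 2 > 0" by simp
    obtain K where K: "\<And>k. k \<ge> K \<Longrightarrow> infdist (xb k) (root_set f) < e / 2"
      using order_tendstoD(2)[OF infdist_xb e] by (auto simp: eventually_sequentially)
    obtain k where "k \<ge> K" "dist (xb k) z < e / 2" using z e unfolding mem_limit_set by blast
    then show "infdist z (root_set f) \<le> 0 + e"
      using K[of k] infdist_triangle[of z "root_set f" "xb k"] by (simp add: dist_commute)
  qed
  then have "infdist z (root_set f) = 0" using infdist_nonneg[of z "root_set f"] by simp
  then show "z \<in> root_set f" using closed_root_set[of f, OF f_cont] assms by (simp add: in_closed_iff_infdist_zero)
qed

end

theorem mainTheorem1:
  fixes P :: "'w measure"
    and f :: "'n::finite \<Rightarrow> real ^ 'l::finite \<Rightarrow> real ^ 'l"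
    and noise :: "'n \<Rightarrow> nat \<Rightarrow> real ^ 'l \<Rightarrow> 'w \<Rightarrow> real ^ 'l"
    and E :: "nat \<Rightarrow> ('n \<times> 'n) set"
    and W :: "nat \<Rightarrow> real ^ 'n ^ 'n"
    and \<gamma> M :: "nat \<Rightarrow> real"
    and xstar :: "real ^ 'l"
    and x0 :: "'n \<Rightarrow> real ^ 'l"
    and x \<epsilon> Obs :: "'n \<Rightarrow> nat \<Rightarrow> 'w \<Rightarrow> real ^ 'l"
    and \<sigma> :: "'n \<Rightarrow> nat \<Rightarrow> 'w \<Rightarrow> nat"
    and \<omega> :: 'w
  defines "J \<equiv> root_set f"
    and "xbar \<equiv> \<lambda>k. avg (\<lambda>i. x i k \<omega>)"
    and "X \<equiv> \<lambda>k. col (\<lambda>i. x i k \<omega>)"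
  assumes "prob_space P"
    and noise_measurable:
      "\<And>i k. (\<lambda>(z, w). noise i (k + 1) z w) \<in> borel_measurable (borel \<Otimes>\<^sub>M P)"
    and graph: "\<And>k. adjacency_matrix (E k) (W k)" "\<And>i k. i \<in> nbrs (E k) i"
    and bounds: "\<And>k. M k > 0" "incseq M" "filterlim M at_top sequentially" "norm xstar \<le> M 0"
    and noise_path:
      "\<And>i k w. w \<in> space P \<Longrightarrow> \<epsilon> i (k + 1) w = noise i (k + 1) (x i k w) w"
    and observation:
      "\<And>i k w. w \<in> space P \<Longrightarrow> Obs i (k + 1) w = f i (x i k w) + \<epsilon> i (k + 1) w"
    and initial: "\<And>i w. w \<in> space P \<Longrightarrow> x i 0 w = x0 i"
    and algorithm:
      "\<And>w. w \<in> space P \<Longrightarrow>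
         dsaawet E W \<gamma> xstar M (\<lambda>i k. Obs i k w) (\<lambda>i k. x i k w) (\<lambda>i k. \<sigma> i k w)"
    and J_nonempty: "J \<noteq> {}"
    and A1: "step_size_cond \<gamma>"
    and A2: "lyapunov_cond (\<lambda>z. avg (\<lambda>i. f i z)) J xstar"
    and A3: "\<And>i. continuous_on UNIV (f i)"
    and A4: "network_cond E W"
    and path: "\<omega> \<in> space P"
    and A5: "noise_cond \<gamma> (\<lambda>i k. x i k \<omega>) (\<lambda>i k. \<epsilon> i k \<omega>)"
  shows "(\<forall>i. bounded (range (\<lambda>k. x i k \<omega>))) \<and>
     (\<exists>k\<^sub>0>0.
        (\<forall>k\<ge>k\<^sub>0. \<forall>i. x i (k + 1) \<omega> =
           (\<Sum>j\<in>nbrs (E k) i. W k $ i $ j *\<^sub>R x j k \<omega>) + \<gamma> k *\<^sub>R Obs i (k + 1) \<omega>) \<and>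
        (\<forall>k\<ge>k\<^sub>0. X (k + 1) = (W k \<otimes>\<^sub>K (mat 1 :: real ^ 'l ^ 'l)) *v X k +
           \<gamma> k *\<^sub>R (col (\<lambda>i. f i (x i k \<omega>)) + col (\<lambda>i. \<epsilon> i (k + 1) \<omega>)))) \<and>
     (\<lambda>k. D_perp *v X k) \<longlonglongrightarrow> 0 \<and>
     (\<lambda>k. infdist (xbar k) J) \<longlonglongrightarrow> 0 \<and>
     (\<exists>Jstar\<subseteq>J. Jstar \<noteq> {} \<and> connected Jstar \<and> (\<lambda>k. infdist (xbar k) Jstar) \<longlonglongrightarrow> 0)"
proof -
  let ?x = "\<lambda>i k. x i k \<omega>" and ?\<epsilon> = "\<lambda>i k. \<epsilon> i k \<omega>" and ?O = "\<lambda>i k. Obs i k \<omega>" and ?\<sigma> = "\<lambda>i k. \<sigma> i k \<omega>"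
  obtain v vx c\<^sub>0 where grad: "\<And>z. GDERIV v z :> vx z" and vx: "continuous_on UNIV vx"
    and shell: "\<And>\<delta> \<Delta>. 0 < \<delta> \<Longrightarrow> \<delta> < \<Delta> \<Longrightarrow>
      (SUP z\<in>{z. \<delta> \<le> infdist z J \<and> infdist z J \<le> \<Delta>}. ereal (avg (\<lambda>i. f i z) \<bullet> vx z)) < 0"
    and nd: "interior (closure (v ` J)) = {}"
    and c0: "c\<^sub>0 > 0" "norm xstar < c\<^sub>0" "v xstar < (INF z\<in>sphere 0 c\<^sub>0. v z)"
    using A2 unfolding lyapunov_cond_def by blast
  obtain \<eta> where eta: "0 < \<eta>" "\<eta> < 1" "\<And>k i j. j \<in> nbrs (E k) i \<Longrightarrow> W k $ i $ j \<ge> \<eta>"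
    using A4 unfolding network_cond_def by blast
  obtain B where B: "B > 0" "\<And>e k. e \<in> persistent_edges E \<Longrightarrow> e \<in> (\<Union>s\<in>{k..<k + B}. E s)"
    using A4 unfolding network_cond_def by blast
  have decrease: "avg (\<lambda>i. f i z) \<bullet> vx z < 0" if "z \<notin> root_set f" for z
  proof -
    \<comment> \<open>J is closed and nonempty, so z has positive distance from it; the shell from
      half this distance up to the distance itself contains z.\<close>
    have d: "infdist z J > 0"
      using that J_nonempty closed_root_set[of f, OF A3] infdist_nonneg[of z J]
      by (auto simp: J_def in_closed_iff_infdist_zero order_less_le)
    have "ereal (avg (\<lambda>i. f i z) \<bullet> vx z) \<le>
        (SUP z\<in>{z'. infdist z J / 2 \<le> infdist z' J \<and> infdist z' J \<le> infdist z J}. ereal (avg (\<lambda>i. f i z) \<bullet> vx z))"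
      using d by (intro SUP_upper) auto
    also have "\<dots> < 0" using d by (intro shell) auto
    finally show ?thesis by simp
  qed
  have v_cont: "continuous_on UNIV v"
    using grad by (auto simp: gderiv_def intro!: continuous_at_imp_continuous_on has_derivative_continuous)
  \<comment> \<open>A real infimum is a lower bound only of a family bounded below, which
    compactness of the sphere provides.\<close>
  have v_sphere: "(INF z\<in>sphere 0 c\<^sub>0. v z) \<le> v z" if "norm z = c\<^sub>0" for z
  proof (rule cINF_lower)
    have "compact (v ` sphere 0 c\<^sub>0)"
      by (intro compact_continuous_image continuous_on_subset[OF v_cont]) auto
    then show "bdd_below (v ` sphere 0 c\<^sub>0)" by (intro bounded_imp_bdd_below compact_imp_bounded)
  qed (use that in auto)
  interpret dsaawet_path E W \<eta> B f \<gamma> ?x ?\<epsilon> v vx M xstar ?O ?\<sigma> c\<^sub>0 "INF z\<in>sphere 0 c\<^sub>0. v z"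
  proof unfold_locales
    show "?O i (Suc k) = f i (?x i k) + ?\<epsilon> i (Suc k)" for i k using observation[OF path, of i k] by simp
    show "dsaawet E W \<gamma> xstar M ?O ?x ?\<sigma>" using algorithm[OF path] .
    show "doubly_stochastic (W k)" "strongly_connected (persistent_edges E)" for k
      using A4 by (auto simp: network_cond_def)
    show "(INF z\<in>sphere 0 c\<^sub>0. v z) \<le> v z" if "norm z = c\<^sub>0" for z using v_sphere that .
    show "interior (closure (v ` root_set f)) = {}" using nd by (simp add: J_def)
  qed (use graph eta B A1 A3 A5 grad vx decrease bounds c0 in auto)
  have xbar: "xbar = xb" by (simp add: xbar_def xb_def fun_eq_iff)
  obtain k0 R where k0: "k0 > 0" "\<And>k. k \<ge> k0 \<Longrightarrow> regular_step k"
    using eventually_regular by blast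
  have step: "?x i (k + 1) = (\<Sum>j\<in>UNIV. W k $ i $ j *\<^sub>R ?x j k) + \<gamma> k *\<^sub>R (f i (?x i k) + ?\<epsilon> i (k + 1))"
    if "k \<ge> k0" for i k
    using k0(2)[OF that] by (simp add: regular_step_def)
  have recursion: "?x i (k + 1) = (\<Sum>j\<in>nbrs (E k) i. W k $ i $ j *\<^sub>R ?x j k) + \<gamma> k *\<^sub>R ?O i (k + 1)"
    if "k \<ge> k0" for i k
    using step[OF that, of i] observation[of i k] by (simp add: sum_nbrs)
  have compact_form: "X (k + 1) = (W k \<otimes>\<^sub>K (mat 1 :: real ^ 'l ^ 'l)) *v X k +
      \<gamma> k *\<^sub>R (col (\<lambda>i. f i (?x i k)) + col (\<lambda>i. ?\<epsilon> i (k + 1)))" if "k \<ge> k0" for k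
    unfolding X_def kronecker_identity_col step[OF that]
    by (simp add: col_def vec_eq_iff)
  have "(\<lambda>k. D_perp *v X k) \<longlonglongrightarrow> 0"
  proof (rule tendstoI)
    fix e :: real assume e: "e > 0"
    \<comment> \<open>The number of coordinates of the stacked vector: if each is at most
      \<open>e / (2 * c)\<close>, their absolute values sum to at most e / 2.\<close>
    define c where "c = real CARD('n \<times> 'l)"
    have c: "c > 0" by (simp add: c_def)
    have "e / (2 * c) > 0" using e c by simp
    from consensus[OF this] show "\<forall>\<^sub>F k in sequentially. dist (D_perp *v X k) 0 < e"
    proof eventually_elim
      case (elim k)
      have "norm (D_perp *v X k) \<le> (\<Sum>p\<in>UNIV. \<bar>(D_perp *v X k) $ p\<bar>)" by (rule norm_le_l1_cart)
      also have "\<dots> \<le> (\<Sum>p\<in>(UNIV :: ('n \<times> 'l) set). e / (2 * c))"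
      proof (rule sum_mono)
        fix p
        have "\<bar>(D_perp *v X k) $ p\<bar> \<le> norm (?x (fst p) k - xb k)"
          unfolding X_def D_perp_col xb_def by (simp add: col_def component_le_norm_cart flip: vector_minus_component)
        also have "\<dots> \<le> e / (2 * c)" using elim by (intro norm_x_minus_xb) auto
        finally show "\<bar>(D_perp *v X k) $ p\<bar> \<le> e / (2 * c)" .
      qed
      also have "\<dots> = e / 2" using c by (simp add: c_def)
      finally show ?case using e by simp
    qed
  qed
  moreover have "\<exists>Jstar\<subseteq>J. Jstar \<noteq> {} \<and> connected Jstar \<and> (\<lambda>k. infdist (xb k) Jstar) \<longlonglongrightarrow> 0"
  \<comment> \<open>Boundedness of the averages makes their limit set nonempty and
    attracting.\<close>
  proof (intro exI[of _ "limit_set xb"] conjI)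
    show "limit_set xb \<subseteq> J" using limit_set_subset J_nonempty by (simp add: J_def)
    show "limit_set xb \<noteq> {}" by (rule limit_set_nonempty[OF bounded_xb])
    show "connected (limit_set xb)" using bounded_xb xb_increments by (rule connected_limit_set)
    show "(\<lambda>k. infdist (xb k) (limit_set xb)) \<longlonglongrightarrow> 0"
      using bounded_xb subsequential_limit_in_limit_set by (rule infdist_tendsto_0)
  qed
  moreover have "\<exists>k\<^sub>0>0.
        (\<forall>k\<ge>k\<^sub>0. \<forall>i. ?x i (k + 1) =
           (\<Sum>j\<in>nbrs (E k) i. W k $ i $ j *\<^sub>R ?x j k) + \<gamma> k *\<^sub>R ?O i (k + 1)) \<and>
        (\<forall>k\<ge>k\<^sub>0. X (k + 1) = (W k \<otimes>\<^sub>K (mat 1 :: real ^ 'l ^ 'l)) *v X k +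
           \<gamma> k *\<^sub>R (col (\<lambda>i. f i (?x i k)) + col (\<lambda>i. ?\<epsilon> i (k + 1))))"
    using k0(1) recursion compact_form by (intro exI[of _ k0] conjI allI impI)
  moreover have "(\<lambda>k. infdist (xb k) J) \<longlonglongrightarrow> 0"
    using infdist_xb by (simp add: J_def)
  ultimately show ?thesis
    unfolding xbar using bounded_x by (intro conjI allI)
qed

end
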